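(* Let $\varrho$ be an irreducible substitution on a compact Hausdorff alphabet $\mathcal{A}$, with normalised substitution operator $T$ and subshift $X$. If $T$ is strongly power convergent, then $X$ is uniquely ergodic and $\varrho$ admits a natural length function. Conversely, if $\varrho$ is irreducible, admits a natural length function and $X$ is uniquely ergodic, then $T$ is strongly power convergent.
   Context: Alphabet and words: $\mathcal{A}$ is a non-empty compact Hausdorff space; $\mathcal{A}^\ast = \bigsqcup_{i\ge 0}\mathcal{A}^i$ is the space of finite words (each $\mathcal{A}^i$ has the product topology, $\mathcal{A}^\ast$ the disjoint union topology, $\mathcal{A}^0=\{\varepsilon\}$ with $\varepsilon$ the empty word). $\#u$ is the length of a word $u$; $v\triangleleft u$ means that $v$ is a (contiguous) subword of the finite or bi-infinite word $u$. Substitutions: a substitution is a continuous map $\varrho\colon\mathcal{A}\to\mathcal{A}^\ast$, extended to $\mathcal{A}^\ast\to\mathcal{A}^\ast$ by concatenation so that it can be iterated. Standing assumption: $\varrho$ generates arbitrarily long words, i.e. for every $k\in\mathbb{N}$ there are $n\in\mathbb{N}$ and $a\in\mathcal{A}$ with $\#\varrho^n(a)\ge k$. $\varrho$ is irreducible if there is no non-empty closed proper subset $\mathcal{B}\subsetneq\mathcal{A}$ with $\varrho(\mathcal{B})\subset\mathcal{B}^\ast$. Subshift: the language $\mathcal{L}(\varrho)$ is the closure in $\mathcal{A}^\ast$ of the set of words $u$ with $u\triangleleft\varrho^n(a)$ for some $n\in\mathbb{N}_0$, $a\in\mathcal{A}$. $X=\{w\in\mathcal{A}^{\mathbb{Z}}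 : \text{every finite } u\triangleleft w \text{ lies in } \mathcal{L}(\varrho)\}$, with the subspace topology of the product topology, and with the left shift $\sigma$. Unique ergodicity: a measure on $X$ is a positive continuous linear functional $\mu$ on $C(X)$ (real continuous functions, sup norm); it is a probability measure if $\mu(\mathbf{1})=1$ and $\sigma$-invariant if $\mu(f\circ\sigma)=\mu(f)$ for all $f\in C(X)$. $X$ is uniquely ergodic if it has exactly one $\sigma$-invariant probability measure. Operators: $E=C(\mathcal{A})$ is the Banach lattice of real continuous functions on $\mathcal{A}$ with sup norm, $K=\{f\in E: f\ge 0\}$. The substitution operator $M\colon E\to E$ is $(Mf)(a)=\sum_{b\triangleleft\varrho(a)}f(b)$, the sum over letters of $\varrho(a)$ with multiplicity. $r$ is the spectral radius of $M$ and $T=\frac1r M$. $T$ is strongly power convergent if $T^nf$ converges in norm in $E$ as $n\to\infty$ for every $f\in E$. A natural length function is a non-zero $\ell\in K$ with $M\ell=\lambda\ell$ for some $\lambda\ge 0$. *)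

theory Defs
  imports "HOL-Analysis.Analysis" "HOL-Library.Sublist"
begin

section \<open>Finite words\<close>

text \<open>
  Lists over a topological space carry the disjoint union topology of the finite powers of the
  space. Words of length \<open>n\<close> are identified with points of the product over the index set
  \<open>{..<n}\<close>, and a set of words is open iff its trace on each power is open.
\<close>

definition words_of_length :: "nat \<Rightarrow> 'a list set \<Rightarrow> (nat \<Rightarrow> 'a) set" where
  "words_of_length n U = {x \<in> {..<n} \<rightarrow>\<^sub>E UNIV. map x [0..<n] \<in> U}"

instantiation list :: (topological_space) topological_space
begin

definition open_list_def:
  "open (U :: 'a list set) \<longleftrightarrow>
     (\<forall>n. openin (product_topology (\<lambda>_. euclidean) {..<n}) (words_of_length n U))"

instance
proof
  have "words_of_length n (UNIV :: 'a list set) = topspace (product_topology (\<lambda>_. euclidean) {..<n})"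
    for n
    by (simp add: words_of_length_def)
  then show "open (UNIV :: 'a list set)"
    unfolding open_list_def by (metis openin_topspace)
next
  fix S T :: "'a list set"
  assume "open S" "open T"
  moreover have "words_of_length n (S \<inter> T) = words_of_length n S \<inter> words_of_length n T" for n
    by (auto simp: words_of_length_def)
  ultimately show "open (S \<inter> T)"
    by (simp add: open_list_def openin_Int)
next
  fix K :: "'a list set set"
  assume "\<forall>S\<in>K. open S"
  moreover have "words_of_length n (\<Union>K) = \<Union>(words_of_length n ` K)" for n
    by (auto simp: words_of_length_def)
  ultimately show "open (\<Union>K)"
    by (auto simp: open_list_def intro!: openin_Union)
qed

end

section \<open>Substitutions\<close>

definition extend_subst :: "('a \<Rightarrow> 'a list) \<Rightarrow> 'a list \<Rightarrow> 'a list" where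
  "extend_subst \<rho> u = concat (map \<rho> u)"

definition substitution :: "('a::topological_space \<Rightarrow> 'a list) \<Rightarrow> bool" where
  "substitution \<rho> \<longleftrightarrow>
     continuous_on UNIV \<rho> \<and> (\<forall>k. \<exists>n a. k \<le> length ((extend_subst \<rho> ^^ n) [a]))"

definition irreducible_subst :: "('a::topological_space \<Rightarrow> 'a list) \<Rightarrow> bool" where
  "irreducible_subst \<rho> \<longleftrightarrow>
     \<not> (\<exists>B. B \<noteq> {} \<and> closed B \<and> B \<subset> UNIV \<and> \<rho> ` B \<subseteq> lists B)"

section \<open>The subshift\<close>

definition language :: "('a::topological_space \<Rightarrow> 'a list) \<Rightarrow> 'a list set" where
  "language \<rho> = closure {u. \<exists>n a. sublist u ((extend_subst \<rho> ^^ n) [a])}"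

definition factor :: "'a list \<Rightarrow> (int \<Rightarrow> 'a) \<Rightarrow> bool" where
  "factor u w \<longleftrightarrow> (\<exists>i. u = map (\<lambda>j. w (i + int j)) [0..<length u])"

definition subshift :: "('a::topological_space \<Rightarrow> 'a list) \<Rightarrow> (int \<Rightarrow> 'a) set" where
  "subshift \<rho> = {w. \<forall>u. factor u w \<longrightarrow> u \<in> language \<rho>}"

definition shift :: "(int \<Rightarrow> 'a) \<Rightarrow> (int \<Rightarrow> 'a)" where
  "shift w = (\<lambda>i. w (i + 1))"

section \<open>Unique ergodicity\<close>

text \<open>
  An element of \<open>C(X)\<close> is represented by any function on the ambient type that is continuous on
  \<open>X\<close>; its values outside \<open>X\<close> are irrelevant. A functional on \<open>C(X)\<close> is therefore required to
  agree on functions that coincide on \<open>X\<close>. It is set to \<open>undefined\<close> on functions that are not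
  continuous on \<open>X\<close>, so that equality of functionals is equality on \<open>C(X)\<close>.
\<close>

definition cont_funs :: "'x::topological_space set \<Rightarrow> ('x \<Rightarrow> real) set" where
  "cont_funs X = {f. continuous_on X f}"

definition functional_on :: "'x::topological_space set \<Rightarrow> (('x \<Rightarrow> real) \<Rightarrow> real) \<Rightarrow> bool" where
  "functional_on X \<mu> \<longleftrightarrow>
     \<mu> \<in> extensional (cont_funs X) \<and>
     (\<forall>f\<in>cont_funs X. \<forall>g\<in>cont_funs X. (\<forall>x\<in>X. f x = g x) \<longrightarrow> \<mu> f = \<mu> g)"

definition positive_measure :: "'x::topological_space set \<Rightarrow> (('x \<Rightarrow> real) \<Rightarrow> real) \<Rightarrow> bool" where
  "positive_measure X \<mu> \<longleftrightarrow>
     functional_on X \<mu> \<and>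
     (\<forall>f\<in>cont_funs X. \<forall>g\<in>cont_funs X. \<mu> (\<lambda>x. f x + g x) = \<mu> f + \<mu> g) \<and>
     (\<forall>f\<in>cont_funs X. \<forall>c. \<mu> (\<lambda>x. c * f x) = c * \<mu> f) \<and>
     (\<exists>B. \<forall>f\<in>cont_funs X. \<bar>\<mu> f\<bar> \<le> B * (SUP x\<in>X. \<bar>f x\<bar>)) \<and>
     (\<forall>f\<in>cont_funs X. (\<forall>x\<in>X. 0 \<le> f x) \<longrightarrow> 0 \<le> \<mu> f)"

definition invariant_probability ::
  "'x::topological_space set \<Rightarrow> ('x \<Rightarrow> 'x) \<Rightarrow> (('x \<Rightarrow> real) \<Rightarrow> real) \<Rightarrow> bool" where
  "invariant_probability X S \<mu> \<longleftrightarrow>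
     positive_measure X \<mu> \<and> \<mu> (\<lambda>_. 1) = 1 \<and> (\<forall>f\<in>cont_funs X. \<mu> (f \<circ> S) = \<mu> f)"

definition uniquely_ergodic :: "'x::topological_space set \<Rightarrow> ('x \<Rightarrow> 'x) \<Rightarrow> bool" where
  "uniquely_ergodic X S \<longleftrightarrow> (\<exists>!\<mu>. invariant_probability X S \<mu>)"

section \<open>Spectral radius and power convergence\<close>

text \<open>
  The spectrum of an operator on a real Banach space is that of its complexification: the pair
  \<open>(f, g)\<close> stands for \<open>f + i g\<close>.
\<close>

definition complexification ::
  "('e::real_normed_vector \<Rightarrow> 'e) \<Rightarrow> 'e \<times> 'e \<Rightarrow> 'e \<times> 'e" where
  "complexification A p = (A (fst p), A (snd p))"

definition complex_scale :: "complex \<Rightarrow> 'e::real_normed_vector \<times> 'e \<Rightarrow> 'e \<times> 'e" where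
  "complex_scale z p =
     (Re z *\<^sub>R fst p - Im z *\<^sub>R snd p, Im z *\<^sub>R fst p + Re z *\<^sub>R snd p)"

definition spectrum :: "('e::real_normed_vector \<Rightarrow> 'e) \<Rightarrow> complex set" where
  "spectrum A =
     {z. \<not> (\<exists>R. bounded_linear R \<and>
               (\<forall>p. R (complex_scale z p - complexification A p) = p) \<and>
               (\<forall>p. complex_scale z (R p) - complexification A (R p) = p))}"

definition spectral_radius :: "('e::real_normed_vector \<Rightarrow> 'e) \<Rightarrow> real" where
  "spectral_radius A = (SUP z\<in>spectrum A. cmod z)"

definition strongly_power_convergent :: "('e::real_normed_vector \<Rightarrow> 'e) \<Rightarrow> bool" where
  "strongly_power_convergent A \<longleftrightarrow> (\<forall>f. convergent (\<lambda>n. (A ^^ n) f))"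

section \<open>The substitution operator\<close>

text \<open>
  On a compact space the bounded continuous functions are all the continuous functions, so
  \<open>'a \<Rightarrow>\<^sub>C real\<close> is the Banach space \<open>C(A)\<close> with the sup norm.
\<close>

definition subst_operator ::
  "('a::topological_space \<Rightarrow> 'a list) \<Rightarrow> ('a \<Rightarrow>\<^sub>C real) \<Rightarrow> ('a \<Rightarrow>\<^sub>C real)" where
  "subst_operator \<rho> f = Bcontfun (\<lambda>a. \<Sum>b\<leftarrow>\<rho> a. apply_bcontfun f b)"

definition normalised_operator ::
  "('a::topological_space \<Rightarrow> 'a list) \<Rightarrow> ('a \<Rightarrow>\<^sub>C real) \<Rightarrow> ('a \<Rightarrow>\<^sub>C real)" where
  "normalised_operator \<rho> f = (1 / spectral_radius (subst_operator \<rho>)) *\<^sub>R subst_operator \<rho> f"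

definition natural_length_function ::
  "('a::topological_space \<Rightarrow> 'a list) \<Rightarrow> ('a \<Rightarrow>\<^sub>C real) \<Rightarrow> bool" where
  "natural_length_function \<rho> l \<longleftrightarrow>
     l \<noteq> 0 \<and> (\<forall>a. 0 \<le> apply_bcontfun l a) \<and> (\<exists>c\<ge>0. subst_operator \<rho> l = c *\<^sub>R l)"

text \<open>
  The function passed to \<^const>\<open>Bcontfun\<close> in \<^const>\<open>subst_operator\<close> is bounded and continuous
  when the alphabet is compact.
\<close>

lemma continuous_on_sum_list_word:
  fixes f :: "'a::topological_space \<Rightarrow> real"
  assumes "continuous_on UNIV f"
  shows "continuous_on UNIV (\<lambda>u. \<Sum>b\<leftarrow>u. f b)"
proof -
  have "open ((\<lambda>u. \<Sum>b\<leftarrow>u. f b) -` V)" if "open V" for V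
    unfolding open_list_def
  proof
    fix n :: nat
    let ?P = "product_topology (\<lambda>_. euclidean :: 'a topology) {..<n}"
    have "continuous_map ?P euclidean (\<lambda>x. f (x i))" if "i < n" for i
    proof -
      have "continuous_map ?P euclidean (\<lambda>x. x i)"
        using that by (intro continuous_map_product_projection) auto
      moreover have "continuous_map euclidean euclidean f"
        using assms by simp
      ultimately show ?thesis
        using continuous_map_compose[of ?P euclidean "\<lambda>x. x i" euclidean f] by (simp add: o_def)
    qed
    then have "continuous_map ?P euclidean (\<lambda>x. \<Sum>i<n. f (x i))"
      by (intro continuous_map_sum) auto
    then have "openin ?P {x \<in> topspace ?P. (\<Sum>i<n. f (x i)) \<in> V}"
      using that by (intro openin_continuous_map_preimage) auto
    moreover have "(\<Sum>b\<leftarrow>map x [0..<n]. f b) = (\<Sum>i<n. f (x i))" for x :: "nat \<Rightarrow> 'a"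
      by (simp add: interv_sum_list_conv_sum_set_nat atLeast0LessThan o_def)
    ultimately show "openin ?P (words_of_length n ((\<lambda>u. \<Sum>b\<leftarrow>u. f b) -` V))"
      by (simp add: words_of_length_def)
  qed
  then show ?thesis
    by (simp add: continuous_on_open_vimage)
qed

lemma apply_subst_operator:
  fixes \<rho> :: "'a::topological_space \<Rightarrow> 'a list"
  assumes "compact (UNIV :: 'a set)" "continuous_on UNIV \<rho>"
  shows "apply_bcontfun (subst_operator \<rho> f) a = (\<Sum>b\<leftarrow>\<rho> a. apply_bcontfun f b)"
proof -
  let ?g = "\<lambda>a. \<Sum>b\<leftarrow>\<rho> a. apply_bcontfun f b"
  have "continuous_on UNIV ?g"
    using continuous_on_compose2[OF continuous_on_sum_list_word assms(2)]
    by (simp add: continuous_on_apply_bcontfun)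
  moreover from this have "bounded (range ?g)"
    using assms(1) compact_continuous_image compact_imp_bounded by blast
  ultimately have "?g \<in> bcontfun"
    by (simp add: bcontfun_def)
  then show ?thesis
    by (simp add: subst_operator_def Bcontfun_inverse)
qed

end

theory Submission
  imports Defs
begin

text \<open>
  Irreducibility makes every natural length function strictly positive, so a natural length function
  forces all lengths \<open>|\<rho>\<^sup>n(a)|\<close> to grow like \<open>r\<^sup>n\<close>, and it spans the fixed space of \<open>T\<close>. Given one,
  strong power convergence of \<open>T\<close> says that letters have uniform frequencies in \<open>\<rho>\<^sup>n(a)\<close>. The sum of
  a local observable over the positions of a word is additive under concatenation up to a bounded
  error; cutting a long word into blocks \<open>\<rho>\<^sup>m(b)\<close> therefore reduces its average to letter frequencies,
  and these averages determine every invariant probability measure. Conversely, a failure of uniform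
  letter frequencies along long words of the language produces, as a limit of empirical measures, a
  second invariant probability measure.

  Two points need separate arguments: that the limit of \<open>T\<^sup>n 1\<close>, the length function, does not vanish,
  and that \<open>r > 0\<close>. The latter holds because \<open>M\<close> is positive with \<open>M 1 \<ge> 1\<close>, and such an operator has
  a real spectral value \<open>t \<ge> 1\<close>.
\<close>

section \<open>Spectra of positive operators\<close>

text \<open>Both directions pass through \<open>letter_frequencies\<close>, a statement about the
  words \<open>iter q [b]\<close> that mentions neither operator nor measure. It is tied to
  \<open>T\<close> by the fact that \<open>M ^^ n\<close> applied to the constant 1 gives the
  lengths of the n-th images of letters. The obstacle is that observables on the subshift see
  several neighbouring letters at once, while \<open>M\<close> counts single letters. It disappears
  on a coarser scale: the sum of an observable over a whole block \<open>iter n [x]\<close> is a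
  continuous function of the one letter \<open>x\<close>. This costs an error per block, so blocks
  must be long for all letters simultaneously; hence \<open>uniform_growth\<close>, which a length
  function supplies. The other obstacle is that \<open>r\<close> is a supremum over a spectrum. It
  is controlled from above by Neumann series, through bounds on all powers \<open>M ^^ n\<close>,
  and from below by exhibiting points of the spectrum.\<close>

text \<open>The library has this instance for metric domains only.\<close>

instance bcontfun :: (topological_space, complete_space) complete_space
proof
  fix f :: "nat \<Rightarrow> 'a \<Rightarrow>\<^sub>C 'b"
  assume "Cauchy f"
  then have "uniformly_Cauchy_on UNIV (\<lambda>n. apply_bcontfun (f n))"
    unfolding uniformly_Cauchy_on_def Cauchy_def by (meson dist_bounded le_less_trans)
  then have "uniformly_convergent_on UNIV (\<lambda>n. apply_bcontfun (f n))"
    by (rule Cauchy_uniformly_convergent)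
  then obtain g where "uniform_limit UNIV (\<lambda>n. apply_bcontfun (f n)) g sequentially"
    by (auto simp: uniformly_convergent_on_def)
  then show "convergent f"
    by (rule uniform_limit_bcontfunE) (auto intro: convergentI)
qed

instance bcontfun :: (topological_space, banach) banach ..

text \<open>The hypothesis bounds the powers and not \<open>onorm A\<close>, so that the radius
  obtained below is the growth rate of the powers. Both inverse identities come from splitting off
  the zeroth term of the series.\<close>

lemma neumann_inverse:
  fixes A :: "'e::banach \<Rightarrow> 'e"
  assumes A: "bounded_linear A"
    and bound: "\<And>n x. norm ((A ^^ n) x) \<le> C * q ^ n * norm x"
    and q: "0 \<le> q" "q < 1"
  obtains R where "bounded_linear R" "\<And>x. R (x - A x) = x" "\<And>x. R x - A (R x) = x"
proof
  interpret A: bounded_linear A by (rule A)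
  define R where "R x = (\<Sum>n. (A ^^ n) x)" for x
  have geo: "summable (\<lambda>n. C * q ^ n * norm x)" for x :: 'e
    using q by (intro summable_mult summable_mult2 summable_geometric) auto
  have summ_norm: "summable (\<lambda>n. norm ((A ^^ n) x))" for x
    by (rule summable_comparison_test'[OF geo[of x], of 0]) (use bound in auto)
  then have summ: "summable (\<lambda>n. (A ^^ n) x)" for x
    by (rule summable_norm_cancel)
  have pow_add: "(A ^^ n) (x + y) = (A ^^ n) x + (A ^^ n) y" for n x y
    by (induction n) (simp_all add: A.add)
  have pow_scale: "(A ^^ n) (c *\<^sub>R x) = c *\<^sub>R (A ^^ n) x" for n c x
    by (induction n) (simp_all add: A.scaleR)
  have norm_R: "norm (R x) \<le> norm x * (\<Sum>n. C * q ^ n)" for x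
  proof -
    have "norm (R x) \<le> (\<Sum>n. norm ((A ^^ n) x))"
      unfolding R_def by (rule summable_norm[OF summ_norm])
    also have "\<dots> \<le> (\<Sum>n. C * q ^ n * norm x)"
      by (intro suminf_le bound summ_norm geo)
    also have "\<dots> = norm x * (\<Sum>n. C * q ^ n)"
      using q by (subst suminf_mult2[symmetric])
        (auto intro!: summable_mult summable_geometric simp: mult.commute)
    finally show ?thesis .
  qed
  show R: "bounded_linear R"
  proof (rule bounded_linear_intro)
    show "R (x + y) = R x + R y" for x y
      unfolding R_def by (simp add: pow_add suminf_add summ)
    show "R (c *\<^sub>R x) = c *\<^sub>R R x" for c x
      unfolding R_def by (simp add: pow_scale suminf_scaleR_right summ)
  qed (rule norm_R)
  have tail: "(\<Sum>n. (A ^^ n) (A x)) = R x - x" for x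
    using suminf_split_head[OF summ[of x]] by (simp add: R_def funpow_swap1)
  show "R (x - A x) = x" for x
  proof -
    have "R (x - A x) = R x - R (A x)"
      by (rule linear_diff[OF bounded_linear.linear[OF R]])
    then show ?thesis
      using tail[of x] by (simp add: R_def)
  qed
  show "R x - A (R x) = x" for x
    using tail[of x] A.suminf[OF summ[of x]] by (simp add: R_def funpow_swap1)
qed

lemma norm_components_le: "norm (fst p) \<le> norm p" "norm (snd p) \<le> norm p"
  by (metis norm_fst_le prod.collapse) (metis norm_snd_le prod.collapse)

lemma norm_complex_scale: "norm (complex_scale z p) \<le> 4 * cmod z * norm p"
proof -
  have *: "\<bar>a\<bar> * norm x \<le> cmod z * norm p"
    if "\<bar>a\<bar> \<le> cmod z" "norm x \<le> norm p" for a :: real and x :: 'a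
    using that by (intro mult_mono) auto
  have "norm (complex_scale z p) \<le>
      norm (Re z *\<^sub>R fst p - Im z *\<^sub>R snd p) + norm (Im z *\<^sub>R fst p + Re z *\<^sub>R snd p)"
    unfolding complex_scale_def by (rule norm_Pair_le)
  also have "\<dots> \<le> (norm (Re z *\<^sub>R fst p) + norm (Im z *\<^sub>R snd p))
      + (norm (Im z *\<^sub>R fst p) + norm (Re z *\<^sub>R snd p))"
    by (intro add_mono norm_triangle_ineq norm_triangle_ineq4)
  also have "\<dots> \<le> 4 * (cmod z * norm p)"
    using *[OF abs_Re_le_cmod norm_components_le(1)]
      *[OF abs_Re_le_cmod norm_components_le(2)]
      *[OF abs_Im_le_cmod norm_components_le(1)]
      *[OF abs_Im_le_cmod norm_components_le(2)]
    by simp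
  finally show ?thesis by simp
qed

lemma complex_scale_complex_scale: "complex_scale z (complex_scale w p) = complex_scale (z * w) p"
  by (simp add: complex_scale_def algebra_simps)

lemma complex_scale_1 [simp]: "complex_scale 1 p = p"
  by (simp add: complex_scale_def)

lemma complex_scale_diff: "complex_scale z (p - q) = complex_scale z p - complex_scale z q"
  by (simp add: complex_scale_def algebra_simps)

lemma bounded_linear_complex_scale: "bounded_linear (complex_scale z)"
  by (rule bounded_linear_intro[where K = "4 * cmod z"])
    (use norm_complex_scale[of z] in \<open>auto simp: complex_scale_def algebra_simps\<close>)

lemma bounded_linear_complexification:
  assumes "bounded_linear A"
  shows "bounded_linear (complexification A)"
  unfolding complexification_def using assms
  by (intro bounded_linear_Pair bounded_linear_compose[OF assms] bounded_linear_fst bounded_linear_snd)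

lemma complexification_complex_scale:
  assumes "linear A"
  shows "complexification A (complex_scale z p) = complex_scale z (complexification A p)"
  by (simp add: complexification_def complex_scale_def linear_diff[OF assms] linear_add[OF assms]
      linear_cmul[OF assms])

text \<open>For \<open>cmod z > q\<close> factor \<open>z - A\<close> as
  \<open>z (1 - A / z)\<close>: the powers of \<open>A / z\<close> decay like
  \<open>(q / cmod z) ^ n\<close>, so a Neumann series inverts it on the complexification. The
  factor 8 below is 4 from \<open>norm_complex_scale\<close> times 2 from the two
  components.\<close>

lemma cmod_le_of_mem_spectrum:
  fixes A :: "'e::banach \<Rightarrow> 'e"
  assumes A: "bounded_linear A"
    and bound: "\<And>n x. norm ((A ^^ n) x) \<le> C * q ^ n * norm x"
    and C: "0 \<le> C" and q: "0 \<le> q" and z: "z \<in> spectrum A"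
  shows "cmod z \<le> q"
proof (rule ccontr)
  assume "\<not> cmod z \<le> q"
  then have zq: "q < cmod z" by simp
  then have z0: "z \<noteq> 0" using q by auto
  note lin = bounded_linear.linear[OF A]
  define B where "B p = complex_scale (inverse z) (complexification A p)" for p
  have B: "bounded_linear B"
    unfolding B_def
    by (rule bounded_linear_compose[OF bounded_linear_complex_scale bounded_linear_complexification[OF A]])
  have B_pow: "(B ^^ n) p = complex_scale (inverse z ^ n) (complexification (A ^^ n) p)" for n p
    by (induction n)
      (simp_all add: B_def complexification_complex_scale[OF lin] complex_scale_complex_scale,
        simp_all add: complexification_def)
  have "norm ((B ^^ n) p) \<le> (8 * C) * (q / cmod z) ^ n * norm p" for n p
  proof -
    have "norm (complexification (A ^^ n) p) \<le> norm ((A ^^ n) (fst p)) + norm ((A ^^ n) (snd p))"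
      unfolding complexification_def by (rule norm_Pair_le)
    also have "\<dots> \<le> C * q ^ n * norm (fst p) + C * q ^ n * norm (snd p)"
      by (intro add_mono bound)
    also have "\<dots> \<le> C * q ^ n * norm p + C * q ^ n * norm p"
      using C q by (intro add_mono mult_left_mono norm_components_le) auto
    finally have *: "norm (complexification (A ^^ n) p) \<le> 2 * (C * q ^ n * norm p)"
      by (simp add: mult_ac)
    have "norm ((B ^^ n) p) \<le> 4 * cmod (inverse z ^ n) * norm (complexification (A ^^ n) p)"
      unfolding B_pow by (rule norm_complex_scale)
    also have "\<dots> \<le> 4 * cmod (inverse z ^ n) * (2 * (C * q ^ n * norm p))"
      by (intro mult_left_mono *) auto
    finally show ?thesis
      by (simp add: norm_power norm_inverse norm_divide power_divide field_simps)
  qed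
  moreover have "0 \<le> q / cmod z" "q / cmod z < 1"
    using q zq by (simp_all add: divide_less_eq)
  ultimately obtain R where R: "bounded_linear R" "\<And>p. R (p - B p) = p" "\<And>p. R p - B (R p) = p"
    using neumann_inverse[OF B] by metis
  have eq: "complex_scale z p - complexification A p = complex_scale z (p - B p)" for p
    using z0 by (simp add: complex_scale_diff B_def complex_scale_complex_scale)
  have "bounded_linear (\<lambda>p. R (complex_scale (inverse z) p))"
    by (rule bounded_linear_compose[OF R(1) bounded_linear_complex_scale])
  moreover have "R (complex_scale (inverse z) (complex_scale z p - complexification A p)) = p" for p
    using z0 by (simp add: eq complex_scale_complex_scale R(2))
  moreover have "complex_scale z (R (complex_scale (inverse z) p))
      - complexification A (R (complex_scale (inverse z) p)) = p" for p
    using z0 by (simp add: eq complex_scale_complex_scale R(3))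
  ultimately have "z \<notin> spectrum A"
    unfolding spectrum_def by blast
  then show False using z by simp
qed

text \<open>A supremum of reals is sure to dominate its members only if the set is bounded; this
  makes \<open>spectral_radius\<close> an upper bound for the spectrum.\<close>

lemma bdd_above_spectrum:
  fixes A :: "'e::banach \<Rightarrow> 'e"
  assumes "bounded_linear A"
  shows "bdd_above (cmod ` spectrum A)"
proof -
  have "norm ((A ^^ n) x) \<le> 1 * onorm A ^ n * norm x" for n x
  proof (induction n)
    case (Suc n)
    have "norm ((A ^^ Suc n) x) \<le> onorm A * norm ((A ^^ n) x)"
      using onorm[OF assms] by simp
    also have "\<dots> \<le> onorm A * (1 * onorm A ^ n * norm x)"
      by (intro mult_left_mono Suc onorm_pos_le[OF assms])
    finally show ?case by (simp add: mult_ac)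
  qed simp
  then have "cmod z \<le> onorm A" if "z \<in> spectrum A" for z
    using cmod_le_of_mem_spectrum[OF assms _ _ onorm_pos_le[OF assms] that, of 1] by simp
  then show ?thesis by (auto intro!: bdd_aboveI)
qed

lemma eigenvalue_mem_spectrum:
  assumes "linear A" "A x = c *\<^sub>R x" "x \<noteq> 0"
  shows "complex_of_real c \<in> spectrum A"
proof (rule ccontr)
  assume "complex_of_real c \<notin> spectrum A"
  then obtain R where "bounded_linear R"
    and R: "\<And>p. R (complex_scale (complex_of_real c) p - complexification A p) = p"
    unfolding spectrum_def by blast
  have "complex_scale (complex_of_real c) (x, 0) - complexification A (x, 0) = 0"
    using assms(2) by (simp add: complex_scale_def complexification_def linear_0[OF assms(1)])
  then have "R 0 = (x, 0)"
    using R[of "(x, 0)"] by simp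
  moreover have "R 0 = 0"
    using \<open>bounded_linear R\<close> by (simp add: linear_simps)
  ultimately show False
    using assms(3) by (simp add: zero_prod_def)
qed

text \<open>For real \<open>c\<close> the operator acts on the two components separately, so the
  first component of the complex resolvent at \<open>(x, 0)\<close> is a real resolvent.\<close>

lemma real_resolvent:
  assumes A: "bounded_linear A" and c: "complex_of_real c \<notin> spectrum A"
  obtains Q where "bounded_linear Q" "\<And>x. Q (c *\<^sub>R x - A x) = x" "\<And>x. c *\<^sub>R Q x - A (Q x) = x"
proof -
  have A0: "A 0 = 0"
    using A by (simp add: linear_simps)
  obtain R where R: "bounded_linear R"
    "\<And>p. R (complex_scale (complex_of_real c) p - complexification A p) = p"
    "\<And>p. complex_scale (complex_of_real c) (R p) - complexification A (R p) = p"
    using c unfolding spectrum_def by blast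
  show thesis
  proof
    show "bounded_linear (\<lambda>x. fst (R (x, 0)))"
      by (intro bounded_linear_fst_comp bounded_linear_compose[OF R(1)] bounded_linear_Pair
          bounded_linear_ident bounded_linear_zero)
    show "fst (R (c *\<^sub>R x - A x, 0)) = x" for x
      using R(2)[of "(x, 0)"] by (simp add: complex_scale_def complexification_def A0)
    show "c *\<^sub>R fst (R (x, 0)) - A (fst (R (x, 0))) = x" for x
      using R(3)[of "(x, 0)"] by (auto simp: complex_scale_def complexification_def prod_eq_iff)
  qed
qed

text \<open>
  The reals \<open>t\<close> for which \<open>t v - M v \<ge> 1\<close> has a solution \<open>v \<ge> 0\<close> form an open set. Were the
  resolvent defined on all of \<open>[\<gamma>, \<infinity>)\<close> for its infimum \<open>\<gamma>\<close>, continuity of the resolvent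
  would put \<open>\<gamma>\<close> into this set.
\<close>

lemma positive_operator_spectrum:
  fixes M :: "('a::topological_space \<Rightarrow>\<^sub>C real) \<Rightarrow> ('a \<Rightarrow>\<^sub>C real)"
  assumes comp: "compact (UNIV :: 'a set)" and M: "bounded_linear M"
    and pos: "\<And>f a. (\<And>b. 0 \<le> apply_bcontfun f b) \<Longrightarrow> 0 \<le> apply_bcontfun (M f) a"
    and one: "\<And>a. 1 \<le> apply_bcontfun (M (const_bcontfun 1)) a"
  obtains t where "1 \<le> t" "complex_of_real t \<in> spectrum M"
proof -
  interpret M: bounded_linear M by (rule M)
  define u :: "'a \<Rightarrow>\<^sub>C real" where "u = const_bcontfun 1"
  have u [simp]: "apply_bcontfun u a = 1" for a
    by (simp add: u_def)
  have u_le: "norm u \<le> 1"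
    by (rule norm_bound) simp
  define P where "P t v \<longleftrightarrow> (\<forall>a. 0 \<le> apply_bcontfun v a) \<and>
    (\<forall>a. 1 \<le> t * apply_bcontfun v a - apply_bcontfun (M v) a)" for t v
  define G where "G = {t. \<exists>v. P t v}"
  \<comment> \<open>At a minimum point \<open>a\<close> of \<open>v\<close>, positivity and
    \<open>M u \<ge> 1\<close> bound \<open>M v\<close> at \<open>a\<close> below by the value of
    \<open>v\<close>; hence 1 is at most \<open>t - 1\<close> times that value.\<close>
  have ge1: "1 < t" if Ptv: "P t v" for t v
  proof -
    obtain a where a: "apply_bcontfun v a \<le> apply_bcontfun v b" for b
      using continuous_attains_inf[OF comp, of "apply_bcontfun v"] by auto
    have "0 \<le> apply_bcontfun (M (v - apply_bcontfun v a *\<^sub>R u)) a"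
      by (rule pos) (simp add: a)
    then have "apply_bcontfun v a * apply_bcontfun (M u) a \<le> apply_bcontfun (M v) a"
      by (simp add: M.diff M.scaleR)
    moreover have "apply_bcontfun v a * 1 \<le> apply_bcontfun v a * apply_bcontfun (M u) a"
      using Ptv one[of a] by (intro mult_left_mono) (auto simp: P_def u_def)
    moreover have "1 \<le> t * apply_bcontfun v a - apply_bcontfun (M v) a" "0 \<le> apply_bcontfun v a"
      using Ptv by (auto simp: P_def)
    ultimately have "1 \<le> (t - 1) * apply_bcontfun v a"
      by (simp add: algebra_simps)
    then show ?thesis
      using \<open>0 \<le> apply_bcontfun v a\<close>
      by (metis diff_gt_0_iff_gt less_eq_real_def less_le_trans not_less zero_less_mult_iff zero_less_one)
  qed
  have "P (norm (M u) + 1) u"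
    unfolding P_def using norm_bounded[of "M u"] by (auto simp: abs_le_iff algebra_simps)
  then have G_ne: "G \<noteq> {}" by (auto simp: G_def)
  have G_bdd: "bdd_below G"
    using ge1 by (intro bdd_belowI[of _ 1]) (auto simp: G_def intro: less_imp_le)
  define \<gamma> where "\<gamma> = Inf G"
  have \<gamma>1: "1 \<le> \<gamma>"
    unfolding \<gamma>_def using ge1 by (intro cInf_greatest G_ne) (auto simp: G_def intro: less_imp_le)
  have "\<gamma> \<notin> G"
  proof
    assume "\<gamma> \<in> G"
    then obtain v where v: "P \<gamma> v" by (auto simp: G_def)
    \<comment> \<open>Lowering \<open>\<gamma>\<close> by \<open>d\<close> costs at most 1/2;
      doubling \<open>v\<close> brings the remaining 1/2 back to 1.\<close>
    define d where "d = 1 / (2 * (norm v + 1))"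
    have d: "0 < d" by (simp add: d_def add_nonneg_pos)
    have "P (\<gamma> - d) (2 *\<^sub>R v)"
      unfolding P_def
    proof (intro conjI allI)
      fix a
      show "0 \<le> apply_bcontfun (2 *\<^sub>R v) a"
        using v by (auto simp: P_def)
      have "d * apply_bcontfun v a \<le> d * norm v"
        using d norm_bounded[of v a] by (intro mult_left_mono) auto
      also have "\<dots> \<le> 1 / 2"
        using norm_ge_zero[of v] by (simp add: d_def field_simps del: norm_ge_zero)
      finally have "d * apply_bcontfun v a \<le> 1 / 2" .
      moreover have "1 \<le> \<gamma> * apply_bcontfun v a - apply_bcontfun (M v) a"
        using v by (auto simp: P_def)
      ultimately show "1 \<le> (\<gamma> - d) * apply_bcontfun (2 *\<^sub>R v) a - apply_bcontfun (M (2 *\<^sub>R v)) a"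
        by (simp add: M.scaleR algebra_simps)
    qed
    then have "\<gamma> \<le> \<gamma> - d"
      unfolding \<gamma>_def by (intro cInf_lower G_bdd) (auto simp: G_def)
    then show False using d by simp
  qed
  \<comment> \<open>A maximum principle: \<open>w\<close> is a strictly positive supersolution at
    \<open>t\<close>. Where \<open>v / w\<close> is minimal, a negative minimum \<open>m\<close>
    would give \<open>1 \<le> m * (t w - M w)\<close>, whose right-hand side is at most 0.\<close>
  have solution: "\<exists>v. (\<forall>a. 0 \<le> apply_bcontfun v a) \<and> t *\<^sub>R v - M v = u"
    if t: "\<gamma> < t" and reg: "complex_of_real t \<notin> spectrum M" for t
  proof -
    obtain s w where w: "P s w" and s: "s < t"
      using cInf_lessD[OF G_ne, of t] t unfolding \<gamma>_def G_def by blast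
    have w1: "1 \<le> t * apply_bcontfun w a - apply_bcontfun (M w) a" for a
    proof -
      have "s * apply_bcontfun w a \<le> t * apply_bcontfun w a"
        using w s by (intro mult_right_mono) (auto simp: P_def)
      then show ?thesis
        using w unfolding P_def by (smt (verit))
    qed
    have w_pos: "0 < apply_bcontfun w a" for a
    proof -
      have "0 \<le> apply_bcontfun (M w) a"
        by (rule pos) (use w in \<open>auto simp: P_def\<close>)
      then have "0 < t * apply_bcontfun w a"
        using w1[of a] by linarith
      then show ?thesis
        using w by (metis P_def less_eq_real_def mult_zero_right)
    qed
    obtain Q where Q: "bounded_linear Q" "\<And>x. t *\<^sub>R Q x - M (Q x) = x"
      using real_resolvent[OF M reg] by metis
    define v where "v = Q u"
    have v: "t *\<^sub>R v - M v = u"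
      unfolding v_def by (rule Q(2))
    have cont: "continuous_on UNIV (\<lambda>a. apply_bcontfun v a / apply_bcontfun w a)"
      using w_pos by (intro continuous_on_divide continuous_on_apply_bcontfun) (auto simp: less_imp_neq[symmetric])
    obtain a where a: "apply_bcontfun v a / apply_bcontfun w a \<le> apply_bcontfun v b / apply_bcontfun w b" for b
      using continuous_attains_inf[OF comp UNIV_not_empty cont] by blast
    define m where "m = apply_bcontfun v a / apply_bcontfun w a"
    have "0 \<le> m"
    proof (rule ccontr)
      assume "\<not> 0 \<le> m"
      then have m: "m < 0" by simp
      have "0 \<le> apply_bcontfun (M (v - m *\<^sub>R w)) a"
      proof (rule pos)
        fix b
        have "m * apply_bcontfun w b \<le> apply_bcontfun v b"
          using a[of b] w_pos[of b] by (simp add: m_def pos_le_divide_eq)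
        then show "0 \<le> apply_bcontfun (v - m *\<^sub>R w) b" by simp
      qed
      then have "m * apply_bcontfun (M w) a \<le> apply_bcontfun (M v) a"
        by (simp add: M.diff M.scaleR)
      moreover have "t * apply_bcontfun v a - apply_bcontfun (M v) a = 1"
        using v by (metis minus_bcontfun.rep_eq real_scaleR_def scaleR_bcontfun.rep_eq u)
      moreover have "apply_bcontfun v a = m * apply_bcontfun w a"
        using w_pos[of a] by (simp add: m_def)
      ultimately have "1 \<le> m * (t * apply_bcontfun w a - apply_bcontfun (M w) a)"
        by (simp add: algebra_simps)
      also have "\<dots> \<le> 0"
        using m w1[of a] by (intro mult_nonpos_nonneg) auto
      finally show False by simp
    qed
    have "0 \<le> apply_bcontfun v b" for b
    proof -
      have "0 \<le> apply_bcontfun v b / apply_bcontfun w b"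
        using a[of b] \<open>0 \<le> m\<close> by (simp add: m_def)
      then show ?thesis
        using w_pos[of b] by (simp add: zero_le_divide_iff)
    qed
    then show ?thesis using v by blast
  qed
  have "\<exists>t\<ge>\<gamma>. complex_of_real t \<in> spectrum M"
  proof (rule ccontr)
    assume "\<not> (\<exists>t\<ge>\<gamma>. complex_of_real t \<in> spectrum M)"
    then have reg: "complex_of_real t \<notin> spectrum M" if "\<gamma> \<le> t" for t
      using that by blast
    obtain Q where Q: "bounded_linear Q" "\<And>x. Q (\<gamma> *\<^sub>R x - M x) = x"
      using real_resolvent[OF M reg[OF order_refl]] by metis
    define N where "N = onorm Q + 1"
    have N: "1 \<le> N" "norm (Q x) \<le> N * norm x" for x
    proof -
      have "norm (Q x) \<le> onorm Q * norm x"
        by (rule onorm[OF Q(1)])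
      also have "\<dots> \<le> N * norm x"
        by (intro mult_right_mono) (auto simp: N_def)
      finally show "norm (Q x) \<le> N * norm x" .
    qed (use onorm_pos_le[OF Q(1)] in \<open>simp add: N_def\<close>)
    \<comment> \<open>With this \<open>d\<close> the estimate
      \<open>norm v \<le> N + norm v / 4\<close> closes, bounding \<open>v\<close> by the resolvent
      at \<open>\<gamma>\<close> alone. Then \<open>d * norm v \<le> 1 / 2\<close>, and doubling
      \<open>v\<close> puts \<open>\<gamma>\<close> into \<open>G\<close>.\<close>
    define d where "d = 1 / (4 * N)"
    have d: "0 < d" "d * N = 1 / 4"
      using N by (auto simp: d_def)
    obtain v where v: "\<And>a. 0 \<le> apply_bcontfun v a" "(\<gamma> + d) *\<^sub>R v - M v = u"
      using solution[of "\<gamma> + d"] reg[of "\<gamma> + d"] d by auto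
    have eq: "\<gamma> *\<^sub>R v - M v = u - d *\<^sub>R v"
      using v(2) by (simp add: algebra_simps)
    have "norm v = norm (Q (u - d *\<^sub>R v))"
      using Q(2)[of v] by (simp add: eq)
    also have "\<dots> \<le> N * norm (u - d *\<^sub>R v)"
      by (rule N(2))
    also have "\<dots> \<le> N * (1 + d * norm v)"
      using norm_triangle_ineq4[of u "d *\<^sub>R v"] d N u_le by (intro mult_left_mono) auto
    also have "\<dots> = N + (d * N) * norm v"
      by (simp add: algebra_simps)
    also have "\<dots> = N + norm v / 4"
      unfolding d(2) by simp
    finally have "norm v \<le> 2 * N"
      using N(1) by linarith
    then have "d * norm v \<le> d * (2 * N)"
      using d by (intro mult_left_mono) auto
    also have "\<dots> = 1 / 2"
      using d(2) by (simp add: mult.left_commute)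
    finally have dv: "d * norm v \<le> 1 / 2" .
    have "P \<gamma> (2 *\<^sub>R v)"
      unfolding P_def
    proof (intro conjI allI)
      fix a
      show "0 \<le> apply_bcontfun (2 *\<^sub>R v) a"
        using v by simp
      have "d * apply_bcontfun v a \<le> d * norm v"
        using norm_bounded[of v a] d by (intro mult_left_mono) auto
      moreover have "\<gamma> * apply_bcontfun v a - apply_bcontfun (M v) a = 1 - d * apply_bcontfun v a"
        using arg_cong[OF eq, of "\<lambda>f. apply_bcontfun f a"] by simp
      ultimately show "1 \<le> \<gamma> * apply_bcontfun (2 *\<^sub>R v) a - apply_bcontfun (M (2 *\<^sub>R v)) a"
        using dv by (simp add: M.scaleR)
    qed
    then show False
      using \<open>\<gamma> \<notin> G\<close> by (auto simp: G_def)
  qed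
  then show thesis
    using that \<gamma>1 order_trans by blast
qed

section \<open>The topology of finite words\<close>

text \<open>Boxes \<open>list_all2 (\<in>) v Us\<close> form a neighbourhood basis that fixes the
  length of a word and splits along append, so concatenation and substitution can be treated without
  product topologies.\<close>

lemma open_word_box:
  assumes "\<forall>U\<in>set Us. open U"
  shows "open {v. list_all2 (\<in>) v Us}"
  unfolding open_list_def
proof
  fix n :: nat
  let ?P = "product_topology (\<lambda>_. euclidean) {..<n}"
  show "openin ?P (words_of_length n {v. list_all2 (\<in>) v Us})"
  proof (cases "n = length Us")
    case True
    have "map x [0..<n] \<in> {v. list_all2 (\<in>) v Us} \<longleftrightarrow> (\<forall>i<n. x i \<in> Us ! i)" for x
      by (simp add: list_all2_conv_all_nth True)
    then have "words_of_length n {v. list_all2 (\<in>) v Us} = PiE {..<n} (\<lambda>i. Us ! i)"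
      unfolding words_of_length_def PiE_def Pi_def by auto
    moreover have "openin ?P (PiE {..<n} (\<lambda>i. Us ! i))"
      using assms True by (simp add: openin_PiE)
    ultimately show ?thesis by simp
  next
    case False
    then have "words_of_length n {v. list_all2 (\<in>) v Us} = {}"
      unfolding words_of_length_def list_all2_conv_all_nth by simp
    then show ?thesis by simp
  qed
qed

lemma word_box_neighbourhood:
  assumes "open W" "u \<in> W"
  obtains Us where "\<forall>U\<in>set Us. open U" "list_all2 (\<in>) u Us" "\<And>v. list_all2 (\<in>) v Us \<Longrightarrow> v \<in> W"
proof -
  define n where "n = length u"
  have as_map: "map (restrict (nth v) {..<n}) [0..<n] = v" if "length v = n" for v :: "'a list"
    using that by (intro nth_equalityI) auto
  let ?P = "product_topology (\<lambda>_. euclidean) {..<n}"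
  have "openin ?P (words_of_length n W)"
    using \<open>open W\<close> by (simp add: open_list_def)
  moreover have "restrict (nth u) {..<n} \<in> words_of_length n W"
    using \<open>u \<in> W\<close> as_map[of u] by (simp add: words_of_length_def n_def)
  ultimately have "\<exists>X. restrict (nth u) {..<n} \<in> PiE {..<n} X \<and> (\<forall>i. openin euclidean (X i)) \<and>
      finite {i. X i \<noteq> topspace euclidean} \<and> PiE {..<n} X \<subseteq> words_of_length n W"
    by (rule product_topology_open_contains_basis)
  then obtain X where X: "restrict (nth u) {..<n} \<in> PiE {..<n} X" "\<And>i. open (X i)"
    "PiE {..<n} X \<subseteq> words_of_length n W"
    unfolding open_openin[symmetric] by blast
  show thesis
  proof
    show "\<forall>U\<in>set (map X [0..<n]). open U"
      using X(2) by auto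
    show "list_all2 (\<in>) u (map X [0..<n])"
      using X(1) by (auto simp: list_all2_conv_all_nth n_def PiE_iff)
  next
    fix v
    assume v: "list_all2 (\<in>) v (map X [0..<n])"
    then have "length v = n"
      by (simp add: list_all2_conv_all_nth)
    moreover from this v have "restrict (nth v) {..<n} \<in> PiE {..<n} X"
      by (auto simp: list_all2_conv_all_nth)
    ultimately have "map (restrict (nth v) {..<n}) [0..<n] \<in> W" "length v = n"
      using X(3) unfolding words_of_length_def by blast+
    then show "v \<in> W"
      by (simp only: as_map)
  qed
qed

lemma continuous_on_wordsI:
  fixes f :: "'a::topological_space list \<Rightarrow> 'b::topological_space"
  assumes "\<And>n. continuous_map (product_topology (\<lambda>_. euclidean) {..<n}) euclidean (\<lambda>x. f (map x [0..<n]))"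
  shows "continuous_on UNIV f"
proof -
  have "open (f -` V)" if "open V" for V
    unfolding open_list_def
  proof
    fix n :: nat
    show "openin (product_topology (\<lambda>_. euclidean) {..<n}) (words_of_length n (f -` V))"
      using openin_continuous_map_preimage[OF assms[of n], of V] that
      by (simp add: words_of_length_def)
  qed
  then show ?thesis
    by (simp add: continuous_on_open_vimage)
qed

lemma continuous_on_word_box:
  assumes "continuous_on S f" "x \<in> S" "list_all2 (\<in>) (f x) Us" "\<forall>U\<in>set Us. open U"
  obtains A where "open A" "x \<in> A" "\<And>y. y \<in> S \<Longrightarrow> y \<in> A \<Longrightarrow> list_all2 (\<in>) (f y) Us"
proof -
  have "f x \<in> {v. list_all2 (\<in>) v Us}"
    using assms(3) by simp
  then have "\<exists>A. open A \<and> x \<in> A \<and> (\<forall>y\<in>S. y \<in> A \<longrightarrow> f y \<in> {v. list_all2 (\<in>) v Us})"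
    using assms(1,2) open_word_box[OF assms(4)] unfolding continuous_on_topological by blast
  then show thesis
    using that by blast
qed

lemma continuous_on_append_words:
  assumes "continuous_on S f" "continuous_on S g"
  shows "continuous_on S (\<lambda>x. f x @ g x)"
  unfolding continuous_on_topological
proof (intro ballI allI impI)
  fix x W
  assume x: "x \<in> S" and W: "open W" "f x @ g x \<in> W"
  obtain Us where Us: "\<forall>U\<in>set Us. open U" "list_all2 (\<in>) (f x @ g x) Us"
    "\<And>v. list_all2 (\<in>) v Us \<Longrightarrow> v \<in> W"
    using word_box_neighbourhood[OF W] by blast
  from Us(2) obtain Vs Ws where VW: "Us = Vs @ Ws" "list_all2 (\<in>) (f x) Vs" "list_all2 (\<in>) (g x) Ws"
    by (auto simp: list_all2_append1)
  have op: "\<forall>U\<in>set Vs. open U" "\<forall>U\<in>set Ws. open U"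
    using Us(1) VW(1) by auto
  obtain A where A: "open A" "x \<in> A" "\<And>y. y \<in> S \<Longrightarrow> y \<in> A \<Longrightarrow> list_all2 (\<in>) (f y) Vs"
    using continuous_on_word_box[OF assms(1) x VW(2) op(1)] by blast
  obtain B where B: "open B" "x \<in> B" "\<And>y. y \<in> S \<Longrightarrow> y \<in> B \<Longrightarrow> list_all2 (\<in>) (g y) Ws"
    using continuous_on_word_box[OF assms(2) x VW(3) op(2)] by blast
  show "\<exists>A. open A \<and> x \<in> A \<and> (\<forall>y\<in>S. y \<in> A \<longrightarrow> f y @ g y \<in> W)"
    using A B Us(3) VW(1) by (intro exI[of _ "A \<inter> B"]) (auto simp: list_all2_appendI)
qed

lemma continuous_on_singleton_word: "continuous_on S (\<lambda>a. [a])"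
  unfolding continuous_on_topological
proof (intro ballI allI impI)
  fix x :: 'a and W
  assume W: "open W" "[x] \<in> W"
  obtain Us where Us: "\<forall>U\<in>set Us. open U" "list_all2 (\<in>) [x] Us"
    "\<And>v. list_all2 (\<in>) v Us \<Longrightarrow> v \<in> W"
    using word_box_neighbourhood[OF W] by blast
  from Us(2) obtain U where "Us = [U]" "x \<in> U"
    by (auto simp: list_all2_Cons1)
  then show "\<exists>A. open A \<and> x \<in> A \<and> (\<forall>y\<in>S. y \<in> A \<longrightarrow> [y] \<in> W)"
    using Us by (intro exI[of _ U]) auto
qed

section \<open>The substitution on words and its language\<close>

lemma extend_subst_simps [simp]:
  "extend_subst \<rho> [] = []"
  "extend_subst \<rho> (a # u) = \<rho> a @ extend_subst \<rho> u"
  "extend_subst \<rho> (u @ v) = extend_subst \<rho> u @ extend_subst \<rho> v"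
  by (simp_all add: extend_subst_def)

text \<open>Induction on \<open>u\<close>, for all targets \<open>W\<close>: a box around
  \<open>extend_subst \<rho> (a # u)\<close> splits into a box for \<open>\<rho> a\<close>, pulled
  back by continuity of \<open>\<rho>\<close>, and a box for the tail, which is the next
  target.\<close>

lemma continuous_on_extend_subst:
  fixes \<rho> :: "'a::topological_space \<Rightarrow> 'a list"
  assumes \<rho>: "continuous_on UNIV \<rho>"
  shows "continuous_on UNIV (extend_subst \<rho>)"
proof -
  have "\<exists>Us. (\<forall>U\<in>set Us. open U) \<and> list_all2 (\<in>) u Us \<and>
      (\<forall>v. list_all2 (\<in>) v Us \<longrightarrow> extend_subst \<rho> v \<in> W)"
    if "open W" "extend_subst \<rho> u \<in> W" for u W
    using that
  proof (induction u arbitrary: W)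
    case Nil
    then show ?case by (intro exI[of _ "[]"]) auto
  next
    case (Cons a u)
    obtain Vs where Vs: "\<forall>U\<in>set Vs. open U" "list_all2 (\<in>) (\<rho> a @ extend_subst \<rho> u) Vs"
      "\<And>v. list_all2 (\<in>) v Vs \<Longrightarrow> v \<in> W"
      using word_box_neighbourhood[OF Cons.prems[unfolded extend_subst_simps]] by blast
    obtain V1 V2 where V: "Vs = V1 @ V2" "list_all2 (\<in>) (\<rho> a) V1" "list_all2 (\<in>) (extend_subst \<rho> u) V2"
      using Vs(2) by (auto simp: list_all2_append1)
    have op: "\<forall>U\<in>set V1. open U" "\<forall>U\<in>set V2. open U"
      using Vs(1) V(1) by auto
    obtain A where A: "open A" "a \<in> A" "\<And>b. b \<in> UNIV \<Longrightarrow> b \<in> A \<Longrightarrow> list_all2 (\<in>) (\<rho> b) V1"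
      using continuous_on_word_box[OF \<rho> UNIV_I V(2) op(1)] by blast
    obtain Us where Us: "\<forall>U\<in>set Us. open U" "list_all2 (\<in>) u Us"
      "\<And>v. list_all2 (\<in>) v Us \<Longrightarrow> list_all2 (\<in>) (extend_subst \<rho> v) V2"
      using Cons.IH[OF open_word_box[OF op(2)]] V(3) by auto
    show ?case
    proof (intro exI[of _ "A # Us"] conjI allI impI)
      fix v
      assume "list_all2 (\<in>) v (A # Us)"
      then obtain b w where "v = b # w" "b \<in> A" "list_all2 (\<in>) w Us"
        by (auto simp: list_all2_Cons2)
      then show "extend_subst \<rho> v \<in> W"
        using A(3) Us(3) V(1) by (auto intro!: Vs(3) list_all2_appendI)
    qed (use A Us in auto)
  qed
  then show ?thesis
    unfolding continuous_on_topological
    by (metis (no_types, lifting) mem_Collect_eq open_word_box)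
qed

lemma continuous_on_funpow:
  fixes f :: "'a::topological_space \<Rightarrow> 'a"
  assumes "continuous_on UNIV f"
  shows "continuous_on UNIV (f ^^ n)"
proof (induction n)
  case 0
  have "f ^^ 0 = (\<lambda>x. x)" by auto
  then show ?case by simp
next
  case (Suc n)
  then show ?case
    using continuous_on_compose2[OF assms Suc] by (simp add: o_def)
qed

text \<open>Padding a box around \<open>v\<close> with full factors \<open>UNIV\<close> gives a box
  around \<open>u\<close>. A word of \<open>S\<close> in it has a subword, again in
  \<open>S\<close>, in the box around \<open>v\<close>.\<close>

lemma sublist_closed_closure:
  assumes S: "\<And>u v. u \<in> S \<Longrightarrow> sublist v u \<Longrightarrow> v \<in> S"
    and u: "u \<in> closure S" and v: "sublist v u"
  shows "v \<in> closure S"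
  unfolding closure_iff_nhds_not_empty
proof (intro allI impI)
  fix A W
  assume W: "W \<subseteq> A" "open W" "v \<in> W"
  obtain Us where Us: "\<forall>U\<in>set Us. open U" "list_all2 (\<in>) v Us"
    "\<And>v. list_all2 (\<in>) v Us \<Longrightarrow> v \<in> W"
    using word_box_neighbourhood[OF W(2,3)] by blast
  obtain p q where u_eq: "u = p @ v @ q"
    using v by (auto simp: sublist_def)
  define Vs where "Vs = replicate (length p) UNIV @ Us @ replicate (length q) (UNIV :: 'a set)"
  have "open {w. list_all2 (\<in>) w Vs}"
    using Us(1) by (intro open_word_box) (auto simp: Vs_def)
  moreover have "list_all2 (\<in>) u Vs"
    using Us(2) by (auto simp: u_eq Vs_def list_all2_conv_all_nth[of _ p] list_all2_conv_all_nth[of _ q]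
        intro!: list_all2_appendI)
  ultimately obtain w where w: "w \<in> S" "list_all2 (\<in>) w Vs"
    using u unfolding closure_iff_nhds_not_empty by blast
  then obtain p' v' q' where "w = p' @ v' @ q'" "list_all2 (\<in>) v' Us"
    by (auto simp: Vs_def list_all2_append2)
  then have "v' \<in> S \<inter> A"
    using S[OF w(1), of v'] Us(3) W(1) by auto
  then show "S \<inter> A \<noteq> {}" by blast
qed

lemma language_sublist:
  assumes "u \<in> language \<rho>" "sublist v u"
  shows "v \<in> language \<rho>"
  using assms unfolding language_def
proof (rule sublist_closed_closure[rotated 1])
  fix u v
  assume "u \<in> {u. \<exists>n a. sublist u ((extend_subst \<rho> ^^ n) [a])}" "sublist v u"
  then show "v \<in> {u. \<exists>n a. sublist u ((extend_subst \<rho> ^^ n) [a])}"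
    using sublist_order.order_trans[of v u] by blast
qed

lemma funpow_extend_subst_append:
  "(extend_subst \<rho> ^^ n) (u @ v) = (extend_subst \<rho> ^^ n) u @ (extend_subst \<rho> ^^ n) v"
  by (induction n) simp_all

lemma funpow_extend_subst_Nil [simp]: "(extend_subst \<rho> ^^ n) [] = []"
  by (induction n) simp_all

lemma funpow_extend_subst_concat:
  "(extend_subst \<rho> ^^ n) u = concat (map (\<lambda>a. (extend_subst \<rho> ^^ n) [a]) u)"
proof (induction u)
  case (Cons a u)
  then show ?case
    using funpow_extend_subst_append[of n \<rho> "[a]" u] by simp
qed simp

lemma funpow_extend_subst_mem_language: "(extend_subst \<rho> ^^ n) [a] \<in> language \<rho>"
  unfolding language_def by (rule subsetD[OF closure_subset]) blast

lemma apply_subst_operator_pow: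
  fixes \<rho> :: "'a::topological_space \<Rightarrow> 'a list"
  assumes "compact (UNIV :: 'a set)" "continuous_on UNIV \<rho>"
  shows "apply_bcontfun ((subst_operator \<rho> ^^ n) f) a =
    (\<Sum>b\<leftarrow>(extend_subst \<rho> ^^ n) [a]. apply_bcontfun f b)"
proof -
  have step: "(\<Sum>b\<leftarrow>u. apply_bcontfun (subst_operator \<rho> g) b) = (\<Sum>b\<leftarrow>extend_subst \<rho> u. apply_bcontfun g b)"
    for g u
    by (induction u) (simp_all add: apply_subst_operator[OF assms])
  \<comment> \<open>Generalised from letters to words, since one application of the operator
    replaces the word by its image.\<close>
  have "(\<Sum>b\<leftarrow>u. apply_bcontfun ((subst_operator \<rho> ^^ n) f) b) =
      (\<Sum>b\<leftarrow>(extend_subst \<rho> ^^ n) u. apply_bcontfun f b)" for u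
  proof (induction n arbitrary: u)
    case (Suc n)
    then show ?case
      by (simp add: step funpow_swap1[of "extend_subst \<rho>"])
  qed simp
  from this[of "[a]"] show ?thesis by simp
qed

lemma bounded_linear_subst_operator:
  fixes \<rho> :: "'a::topological_space \<Rightarrow> 'a list"
  assumes "compact (UNIV :: 'a set)" "continuous_on UNIV \<rho>"
  shows "bounded_linear (subst_operator \<rho>)"
proof -
  note app = apply_subst_operator[OF assms]
  define u :: "'a \<Rightarrow>\<^sub>C real" where "u = const_bcontfun 1"
  show ?thesis
  proof (rule bounded_linear_intro)
    show "subst_operator \<rho> (f + g) = subst_operator \<rho> f + subst_operator \<rho> g" for f g
      by (rule bcontfun_eqI) (simp add: app sum_list_addf)
    show "subst_operator \<rho> (c *\<^sub>R f) = c *\<^sub>R subst_operator \<rho> f" for c f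
      by (rule bcontfun_eqI) (simp add: app sum_list_const_mult)
    show "norm (subst_operator \<rho> f) \<le> norm f * norm (subst_operator \<rho> u)" for f
    proof (rule norm_bound)
      fix a
      have "norm (apply_bcontfun (subst_operator \<rho> f) a) \<le> (\<Sum>b\<leftarrow>\<rho> a. \<bar>apply_bcontfun f b\<bar>)"
        using sum_list_abs[of "map (apply_bcontfun f) (\<rho> a)"] by (simp add: app o_def)
      also have "\<dots> \<le> (\<Sum>b\<leftarrow>\<rho> a. norm f)"
        using norm_bounded[of f] by (intro sum_list_mono) auto
      also have "\<dots> = norm f * apply_bcontfun (subst_operator \<rho> u) a"
        by (simp add: app u_def sum_list_triv mult.commute)
      also have "\<dots> \<le> norm f * norm (subst_operator \<rho> u)"
        using norm_bounded[of "subst_operator \<rho> u" a] by (intro mult_left_mono) auto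
      finally show "norm (apply_bcontfun (subst_operator \<rho> f) a) \<le> \<dots>" .
    qed
  qed
qed

section \<open>Averages of quasi-additive functions\<close>

lemma compact_bounded_real:
  fixes f :: "'a::topological_space \<Rightarrow> real"
  assumes "compact S" "continuous_on S f"
  obtains B where "0 \<le> B" "\<And>x. x \<in> S \<Longrightarrow> \<bar>f x\<bar> \<le> B"
proof -
  have "bounded (f ` S)"
    using assms compact_continuous_image compact_imp_bounded by blast
  then obtain B where "\<And>x. x \<in> S \<Longrightarrow> \<bar>f x\<bar> \<le> B"
    by (auto simp: bounded_real)
  then show thesis
    using that[of "max 0 B"] by (auto intro: max.coboundedI2)
qed

text \<open>A subword cuts at most one block at each end. If it lies inside a single block, it
  becomes a short end piece as a whole, still bounded by \<open>L\<close>.\<close>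

lemma sublist_concat_decomposition:
  assumes sub: "sublist u (concat (map g v))" and L: "\<And>b. length (g b) \<le> L"
  obtains p w t where "u = p @ concat (map g w) @ t" "length p \<le> L" "length t \<le> L"
proof -
  have pre: "\<exists>w t. u = concat (map g w) @ t \<and> length t \<le> L" if "prefix u (concat (map g v))" for u v
    using that
  proof (induction v arbitrary: u)
    case Nil
    then show ?case by (intro exI[of _ "[]"]) simp
  next
    case (Cons b v)
    then consider "prefix u (g b)" | us where "u = g b @ us" "prefix us (concat (map g v))"
      by (auto simp: prefix_append)
    then show ?case
    proof cases
      case 1
      then have "length u \<le> L"
        using L[of b] prefix_length_le le_trans by blast
      then show ?thesis
        by (intro exI[of _ "[]"] exI[of _ u]) simp
    next
      case 2
      with Cons.IH obtain w t where "us = concat (map g w) @ t" "length t \<le> L"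
        by blast
      with 2 show ?thesis
        by (intro exI[of _ "b # w"] exI[of _ t]) simp
    qed
  qed
  have "\<exists>p w t. u = p @ concat (map g w) @ t \<and> length p \<le> L \<and> length t \<le> L"
    using sub
  proof (induction v)
    case Nil
    then show ?case by (intro exI[of _ "[]"]) simp
  next
    case (Cons b v)
    then consider "sublist u (g b)" | "sublist u (concat (map g v))"
      | p q where "u = p @ q" "suffix p (g b)" "prefix q (concat (map g v))"
      by (auto simp: sublist_append)
    then show ?case
    proof cases
      case 1
      then have "length u \<le> L"
        using L[of b] sublist_length_le le_trans by blast
      then show ?thesis
        by (intro exI[of _ u] exI[of _ "[]"]) simp
    next
      case 2
      then show ?thesis by (rule Cons.IH)
    next
      case 3
      then have "length p \<le> L"
        using L[of b] suffix_length_le le_trans by blast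
      moreover obtain w t where "q = concat (map g w) @ t" "length t \<le> L"
        using pre[OF 3(3)] by blast
      ultimately show ?thesis
        using 3(1) by (intro exI[of _ p] exI[of _ w] exI[of _ t]) simp
    qed
  qed
  then show thesis using that by blast
qed

text \<open>Models sums of a finite-range observable: \<open>D\<close> pays for the positions near a
  join, where letters from both sides are seen. It is independent of the two words, so a
  concatenation loses at most \<open>D\<close> per block.\<close>

locale quasi_additive =
  fixes S :: "'a list \<Rightarrow> real" and D :: real
  assumes Nil [simp]: "S [] = 0"
    and append: "\<bar>S (u @ v) - S u - S v\<bar> \<le> D"
begin

lemma defect_nonneg: "0 \<le> D"
  using append[of "[]" "[]"] by simp

lemma abs_append_le: "\<bar>S (u @ v)\<bar> \<le> \<bar>S u\<bar> + \<bar>S v\<bar> + D"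
  using append[of u v] by linarith

lemma concat: "\<bar>S (concat us) - (\<Sum>u\<leftarrow>us. S u)\<bar> \<le> D * real (length us)"
proof (induction us)
  case (Cons u us)
  then show ?case
    using append[of u "concat us"] by (simp add: algebra_simps)
qed simp

lemma concat_map: "\<bar>S (concat (map g w)) - (\<Sum>b\<leftarrow>w. S (g b))\<bar> \<le> D * real (length w)"
  using concat[of "map g w"] by (simp add: o_def)

lemma abs_le_length:
  assumes "\<And>a. \<bar>S [a]\<bar> \<le> B"
  shows "\<bar>S u\<bar> \<le> (B + D) * real (length u)"
proof (induction u)
  case (Cons a u)
  then show ?case
    using abs_append_le[of "[a]" u] assms[of a] by (simp add: algebra_simps)
qed simp

text \<open>Length is exactly additive, so a candidate average can be subtracted without changing
  the defect.\<close>

lemma minus_length: "quasi_additive (\<lambda>u. S u - c * real (length u)) D"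
  by standard (use append in \<open>simp_all add: algebra_simps\<close>)

end

section \<open>Irreducible substitutions, growth and block averages\<close>

locale irreducible_substitution =
  fixes \<rho> :: "'a::t2_space \<Rightarrow> 'a list"
  assumes compact_alphabet: "compact (UNIV :: 'a set)"
    and subst: "substitution \<rho>"
    and irred: "irreducible_subst \<rho>"
begin

abbreviation iter :: "nat \<Rightarrow> 'a list \<Rightarrow> 'a list" where
  "iter n \<equiv> extend_subst \<rho> ^^ n"

lemma continuous_subst: "continuous_on UNIV \<rho>"
  using subst by (simp add: substitution_def)

lemma invariant_closed_set:
  assumes "closed B" "B \<noteq> {}" "\<And>a b. a \<in> B \<Longrightarrow> b \<in> set (\<rho> a) \<Longrightarrow> b \<in> B"
  shows "B = UNIV"
proof (rule ccontr)
  assume "B \<noteq> UNIV"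
  moreover have "\<rho> ` B \<subseteq> lists B"
    using assms(3) by auto
  ultimately show False
    using irred assms(1,2) unfolding irreducible_subst_def by blast
qed

text \<open>A letter with empty image would by itself be a closed invariant set, hence the whole
  alphabet, and no iterate of a letter would be longer than one letter.\<close>

lemma image_nonempty: "\<rho> a \<noteq> []"
proof
  assume a: "\<rho> a = []"
  have "{a} = UNIV"
    by (rule invariant_closed_set) (auto simp: a)
  then have all: "\<rho> b = []" for b
    using a by (metis UNIV_I singletonD)
  have "length (iter n [b]) \<le> 1" for n b
  proof (cases n)
    case (Suc m)
    have "extend_subst \<rho> u = []" for u
      by (induction u) (simp_all add: all)
    then show ?thesis by (simp add: Suc)
  qed simp
  moreover obtain n b where "2 \<le> length (iter n [b])"
    using subst unfolding substitution_def by blast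
  ultimately show False
    by (metis le_trans not_less_eq_eq numeral_2_eq_2 order_refl One_nat_def)
qed

lemma length_extend_subst: "length u \<le> length (extend_subst \<rho> u)"
proof (induction u)
  case (Cons a u)
  then show ?case
    using image_nonempty[of a] by (cases "\<rho> a") auto
qed simp

lemma length_iter_mono:
  assumes "n \<le> m"
  shows "length (iter n u) \<le> length (iter m u)"
  using assms by (induction m rule: dec_induct) (auto intro: order_trans length_extend_subst)

lemma length_iter_pos: "0 < length (iter n [a])"
  using length_iter_mono[of 0 n "[a]"] by (auto simp: less_eq_Suc_le)

lemma iter_add: "iter (n + m) u = iter n (iter m u)"
  by (simp add: funpow_add)

lemma continuous_on_iter_letter:
  assumes "continuous_on UNIV S"
  shows "continuous_on UNIV (\<lambda>a. S (iter n [a]))"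
  by (intro continuous_on_compose2[OF assms]
      continuous_on_compose2[OF continuous_on_funpow[OF continuous_on_extend_subst[OF continuous_subst]]]
      continuous_on_singleton_word) auto

lemma continuous_on_length: "continuous_on UNIV (\<lambda>u :: 'a list. real (length u))"
  using continuous_on_sum_list_word[of "\<lambda>_ :: 'a. 1 :: real"] by (simp add: sum_list_triv)

lemma iter_letters_bounded:
  obtains L where "\<And>a. length (iter n [a]) \<le> L"
proof -
  obtain B where "\<And>a. \<bar>real (length (iter n [a]))\<bar> \<le> B"
    using compact_bounded_real[OF compact_alphabet continuous_on_iter_letter[OF continuous_on_length, of n]]
    by auto
  then show thesis
    using that[of "nat \<lceil>B\<rceil>"] by (metis abs_of_nat le_nat_iff of_nat_ceiling of_nat_le_iff order_trans real_nat_ceiling_ge)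
qed

text \<open>Uniform in \<open>b\<close>, with \<open>c\<close> depending on \<open>f\<close> alone.
  In the uniquely ergodic case \<open>c\<close> is the integral of \<open>f\<close> read at the
  origin.\<close>

definition letter_frequencies :: bool where
  "letter_frequencies \<longleftrightarrow> (\<forall>f :: 'a \<Rightarrow> real. continuous_on UNIV f \<longrightarrow> (\<exists>c. \<forall>e>0. \<exists>Q. \<forall>q\<ge>Q. \<forall>b.
     \<bar>(\<Sum>x\<leftarrow>iter q [b]. f x) - c * real (length (iter q [b]))\<bar> \<le> e * real (length (iter q [b]))))"

text \<open>A substitution is only assumed to have long images of some letter; cutting into blocks
  needs them for every letter.\<close>

definition uniform_growth :: bool where
  "uniform_growth \<longleftrightarrow> (\<forall>k. \<exists>N. \<forall>n\<ge>N. \<forall>a. k \<le> length (iter n [a]))"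

lemma language_decomposition:
  assumes "sublist u (iter k [a])" and L: "\<And>b. length (iter m [b]) \<le> L"
  obtains p w t where "u = p @ iter m w @ t" "length p \<le> L" "length t \<le> L"
proof (cases "m \<le> k")
  case True
  then have "iter k [a] = iter m (iter (k - m) [a])"
    using iter_add[of m "k - m" "[a]"] by simp
  then have "sublist u (concat (map (\<lambda>b. iter m [b]) (iter (k - m) [a])))"
    using assms(1) funpow_extend_subst_concat by metis
  then show thesis
    by (rule sublist_concat_decomposition[OF _ L])
      (use that funpow_extend_subst_concat[of m \<rho>] in metis)
next
  \<comment> \<open>For \<open>k < m\<close> the word \<open>iter k [a]\<close> is no longer than
    \<open>iter m [a]\<close>, so \<open>u\<close> itself serves as the short piece
    \<open>p\<close>.\<close>
  case False
  then have "length u \<le> L"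
    using sublist_length_le[OF assms(1)] length_iter_mono[of k m "[a]"] L[of a] by linarith
  then show thesis
    using that[of u "[]" "[]"] by simp
qed

text \<open>Two scales, \<open>m = n + q\<close>. First \<open>n\<close> makes every block
  \<open>iter n [x]\<close> so long that an error \<open>D + 2\<close> per block is relatively
  small; then \<open>q\<close> brings the averages of block sum and block length over the letters of
  \<open>iter q [b]\<close> close to \<open>c\<close> and \<open>d\<close>. The value
  \<open>\<beta> = c / d\<close> is mean block sum over mean block length.\<close>

lemma quasi_additive_iter:
  assumes freq: letter_frequencies and growth: uniform_growth
    and "continuous_on UNIV S" and qa: "quasi_additive S D" and e: "0 < e"
  obtains \<beta> m where "\<And>b. \<bar>S (iter m [b]) - \<beta> * real (length (iter m [b]))\<bar> \<le> e * real (length (iter m [b]))"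
    "\<And>b. D \<le> e * real (length (iter m [b]))"
proof -
  interpret S: quasi_additive S D by (rule qa)
  \<comment> \<open>Per block: \<open>D\<close> for the join, 1 for the frequency error of the sums,
    1 for that of the lengths.\<close>
  obtain k where k: "(D + 2) / e \<le> real k"
    using real_arch_simple by blast
  obtain n where n: "\<And>a. k \<le> length (iter n [a])"
    using growth unfolding uniform_growth_def by blast
  have big: "(D + 2) * real (length u) \<le> e * real (length (iter n u))" for u
  proof (induction u)
    case (Cons a u)
    have "D + 2 \<le> e * real (length (iter n [a]))"
    proof -
      have "(D + 2) / e \<le> real (length (iter n [a]))"
        using k n[of a] by linarith
      then show ?thesis
        using e by (simp add: field_simps)
    qed
    then show ?case
      using Cons funpow_extend_subst_append[of n \<rho> "[a]" u] by (simp add: algebra_simps)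
  qed simp
  obtain c where c: "\<And>e. 0 < e \<Longrightarrow> \<exists>Q. \<forall>q\<ge>Q. \<forall>b.
      \<bar>(\<Sum>x\<leftarrow>iter q [b]. S (iter n [x])) - c * real (length (iter q [b]))\<bar> \<le> e * real (length (iter q [b]))"
    using freq continuous_on_iter_letter[OF assms(3), of n] unfolding letter_frequencies_def by blast
  obtain d where d: "\<And>e. 0 < e \<Longrightarrow> \<exists>Q. \<forall>q\<ge>Q. \<forall>b.
      \<bar>(\<Sum>x\<leftarrow>iter q [b]. real (length (iter n [x]))) - d * real (length (iter q [b]))\<bar> \<le> e * real (length (iter q [b]))"
    using freq continuous_on_iter_letter[OF continuous_on_length, of n]
    unfolding letter_frequencies_def by blast
  have len_sum: "(\<Sum>x\<leftarrow>u. real (length (iter n [x]))) = length (iter n u)" for u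
    by (subst (2) funpow_extend_subst_concat) (induction u, simp_all)
  \<comment> \<open>Each block has at least one letter, so the tolerance 1/2 already forces
    \<open>d \<ge> 1 / 2\<close>.\<close>
  have "0 < d"
  proof -
    obtain q where q: "\<And>b. \<bar>real (length (iter n (iter q [b]))) - d * real (length (iter q [b]))\<bar>
        \<le> 1 / 2 * real (length (iter q [b]))"
      using d[of "1 / 2"] unfolding len_sum by auto
    have "real (length (iter q [undefined])) \<le> length (iter n (iter q [undefined]))"
      using length_iter_mono[of 0 n] by simp
    with q[of undefined] have "1 / 2 * real (length (iter q [undefined])) \<le> d * real (length (iter q [undefined]))"
      by linarith
    then show ?thesis
      using length_iter_pos[of q undefined] by (simp add: field_simps)
  qed
  define \<beta> where "\<beta> = c / d"
  have c_eq: "c = \<beta> * d"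
    using \<open>0 < d\<close> by (simp add: \<beta>_def)
  obtain Q1 where Q1: "\<And>q b. Q1 \<le> q \<Longrightarrow>
      \<bar>(\<Sum>x\<leftarrow>iter q [b]. S (iter n [x])) - c * real (length (iter q [b]))\<bar> \<le> 1 * real (length (iter q [b]))"
    using c[of 1] by auto
  \<comment> \<open>The length error gets multiplied by \<open>\<beta>\<close>, so its tolerance is
    divided by \<open>\<bar>\<beta>\<bar> + 1\<close>; the summand 1 covers
    \<open>\<beta> = 0\<close>.\<close>
  obtain Q2 where Q2: "\<And>q b. Q2 \<le> q \<Longrightarrow>
      \<bar>real (length (iter n (iter q [b]))) - d * real (length (iter q [b]))\<bar> \<le> 1 / (\<bar>\<beta>\<bar> + 1) * real (length (iter q [b]))"
    using d[of "1 / (\<bar>\<beta>\<bar> + 1)"] unfolding len_sum by (auto simp: add_nonneg_pos)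
  define q where "q = max Q1 Q2"
  show thesis
  proof
    fix b
    let ?l = "real (length (iter q [b]))" and ?L = "real (length (iter n (iter q [b])))"
    have 1: "\<bar>S (iter n (iter q [b])) - (\<Sum>x\<leftarrow>iter q [b]. S (iter n [x]))\<bar> \<le> D * ?l"
      using S.concat_map[of "\<lambda>x. iter n [x]" "iter q [b]"]
      by (simp add: funpow_extend_subst_concat[of n \<rho> "iter q [b]"])
    have 2: "\<bar>(\<Sum>x\<leftarrow>iter q [b]. S (iter n [x])) - c * ?l\<bar> \<le> ?l"
      using Q1[of q b] by (simp add: q_def)
    have 3: "\<bar>c * ?l - \<beta> * ?L\<bar> \<le> ?l"
    proof -
      have "\<bar>c * ?l - \<beta> * ?L\<bar> = \<bar>\<beta>\<bar> * \<bar>?L - d * ?l\<bar>"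
        unfolding abs_mult[symmetric] by (simp add: c_eq algebra_simps abs_minus_commute)
      also have "\<dots> \<le> \<bar>\<beta>\<bar> * (1 / (\<bar>\<beta>\<bar> + 1) * ?l)"
        using Q2[of q b] by (intro mult_left_mono) (auto simp: q_def)
      also have "\<dots> = (\<bar>\<beta>\<bar> / (\<bar>\<beta>\<bar> + 1)) * ?l"
        by simp
      also have "\<dots> \<le> 1 * ?l"
        by (intro mult_right_mono) (auto simp: divide_le_eq)
      finally show ?thesis by simp
    qed
    have "\<bar>S (iter n (iter q [b])) - \<beta> * ?L\<bar> \<le> (D + 2) * ?l"
      using 1 2 3 by (simp add: algebra_simps)
    also have "\<dots> \<le> e * ?L"
      by (rule big)
    finally show "\<bar>S (iter (n + q) [b]) - \<beta> * real (length (iter (n + q) [b]))\<bar> \<le> e * real (length (iter (n + q) [b]))"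
      by (simp only: iter_add)
    have "D * 1 \<le> (D + 2) * ?l"
      using S.defect_nonneg length_iter_pos[of q b] by (intro mult_mono) (auto simp: Suc_le_eq)
    also have "\<dots> \<le> e * ?L"
      by (rule big)
    finally show "D \<le> e * real (length (iter (n + q) [b]))"
      by (simp add: iter_add)
  qed
qed

text \<open>Whole blocks have the right average up to \<open>e / 4\<close>, and their joins cost
  another \<open>e / 4\<close>, because \<open>D\<close> is at most that fraction of each block. The
  two incomplete ends contribute a constant \<open>K\<close>, which is at most \<open>e / 2\<close>
  times the length once the word is long.\<close>

lemma quasi_additive_average:
  assumes freq: letter_frequencies and growth: uniform_growth
    and cont: "continuous_on UNIV S" and qa: "quasi_additive S D" and e: "0 < e"
  obtains \<beta> N where "\<And>u. u \<in> language \<rho> \<Longrightarrow> N \<le> length u \<Longrightarrow> \<bar>S u - \<beta> * real (length u)\<bar> \<le> e * real (length u)"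
proof -
  have e4: "0 < e / 4" using e by simp
  obtain \<beta> m where \<beta>: "\<And>b. \<bar>S (iter m [b]) - \<beta> * real (length (iter m [b]))\<bar> \<le> e / 4 * real (length (iter m [b]))"
    and m: "\<And>b. D \<le> e / 4 * real (length (iter m [b]))"
    using quasi_additive_iter[OF freq growth cont qa e4] by metis
  define S' where "S' u = S u - \<beta> * real (length u)" for u
  interpret S': quasi_additive S' D
    unfolding S'_def by (rule quasi_additive.minus_length[OF qa])
  have cont': "continuous_on UNIV S'"
    unfolding S'_def by (intro continuous_intros cont continuous_on_length)
  obtain L where L: "\<And>a. length (iter m [a]) \<le> L"
    using iter_letters_bounded[of m] by metis
  obtain B where B: "0 \<le> B" "\<And>a. \<bar>S' [a]\<bar> \<le> B"
    using compact_bounded_real[OF compact_alphabet continuous_on_iter_letter[OF cont', of 0]] by auto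
  \<comment> \<open>Two end pieces of length at most \<open>L\<close>, and the two joins that attach
    them.\<close>
  define K where "K = 2 * ((B + D) * L) + 2 * D"
  have inner: "\<bar>S' (iter m w)\<bar> \<le> e / 2 * real (length (iter m w))" for w
  proof -
    have len: "real (length (iter m w)) = (\<Sum>b\<leftarrow>w. real (length (iter m [b])))"
      by (subst funpow_extend_subst_concat) (induction w, simp_all)
    have "\<bar>S' (iter m w)\<bar> \<le> \<bar>\<Sum>b\<leftarrow>w. S' (iter m [b])\<bar> + D * real (length w)"
      using S'.concat_map[of "\<lambda>b. iter m [b]" w] by (simp add: funpow_extend_subst_concat[of m \<rho> w])
    also have "\<dots> \<le> (\<Sum>b\<leftarrow>w. \<bar>S' (iter m [b])\<bar>) + (\<Sum>b\<leftarrow>w. D)"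
      using sum_list_abs[of "map (\<lambda>b. S' (iter m [b])) w"] by (simp add: o_def sum_list_triv mult.commute)
    also have "\<dots> \<le> (\<Sum>b\<leftarrow>w. e / 4 * real (length (iter m [b]))) + (\<Sum>b\<leftarrow>w. e / 4 * real (length (iter m [b])))"
      using \<beta> m by (intro add_mono sum_list_mono) (auto simp: S'_def)
    also have "\<dots> = e / 2 * real (length (iter m w))"
      unfolding len sum_list_const_mult by simp
    finally show ?thesis .
  qed
  define N where "N = nat \<lceil>2 * K / e\<rceil>"
  have exact: "\<bar>S' u\<bar> \<le> e * real (length u)" if sub: "sublist u (iter k [a])" and len: "N \<le> length u" for u k a
  proof -
    obtain p w t where u: "u = p @ iter m w @ t" "length p \<le> L" "length t \<le> L"
      using language_decomposition[OF sub L] by metis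
    have short: "\<bar>S' v\<bar> \<le> (B + D) * L" if "length v \<le> L" for v
    proof -
      have "(B + D) * real (length v) \<le> (B + D) * L"
        using that B(1) S'.defect_nonneg by (intro mult_left_mono) auto
      then show ?thesis
        using S'.abs_le_length[OF B(2), of v] by linarith
    qed
    have "\<bar>S' u\<bar> \<le> K + \<bar>S' (iter m w)\<bar>"
      using short[OF u(2)] short[OF u(3)] S'.abs_append_le[of p "iter m w @ t"]
        S'.abs_append_le[of "iter m w" t]
      unfolding K_def u(1) by linarith
    also have "\<dots> \<le> K + e / 2 * real (length (iter m w))"
      using inner by simp
    also have "\<dots> \<le> e / 2 * real (length u) + e / 2 * real (length u)"
    proof (rule add_mono)
      have "2 * K / e \<le> length u"
        using len unfolding N_def by linarith
      then show "K \<le> e / 2 * real (length u)"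
        using e by (simp add: field_simps)
      show "e / 2 * real (length (iter m w)) \<le> e / 2 * real (length u)"
        using e u(1) by (intro mult_left_mono) auto
    qed
    finally show ?thesis by simp
  qed
  \<comment> \<open>The language is a closure, so the estimate is passed on as membership in a
    closed set. Words shorter than \<open>N\<close> are exempted by a closed condition, with
    \<open>N - 1\<close> computed in the reals so that \<open>N = 0\<close> exempts none.\<close>
  let ?C = "{u. real (length u) \<le> real N - 1} \<union> {u. \<bar>S' u\<bar> \<le> e * real (length u)}"
  have "closed ?C"
    by (intro closed_Un closed_Collect_le continuous_intros cont' continuous_on_length)
  moreover have "{u. \<exists>n a. sublist u (iter n [a])} \<subseteq> ?C"
  proof
    fix u
    assume "u \<in> {u. \<exists>n a. sublist u (iter n [a])}"
    then show "u \<in> ?C"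
      using exact[of u] by (cases "N \<le> length u") auto
  qed
  ultimately have "language \<rho> \<subseteq> ?C"
    unfolding language_def by (rule closure_minimal[rotated])
  then have "\<bar>S u - \<beta> * real (length u)\<bar> \<le> e * real (length u)" if "u \<in> language \<rho>" "N \<le> length u" for u
    using that unfolding S'_def by auto
  then show thesis by (rule that)
qed

end

section \<open>Orbits and the subshift\<close>

lemma open_coordinate_vimage: "open A \<Longrightarrow> open ((\<lambda>w. w i) -` A)"
  by (rule open_vimage) simp_all

instance "fun" :: (type, t0_space) t0_space
proof
  fix x y :: "'a \<Rightarrow> 'b"
  assume "x \<noteq> y"
  then obtain i where "x i \<noteq> y i" by auto
  then obtain U where "open U" "\<not> (x i \<in> U \<longleftrightarrow> y i \<in> U)"
    using separation_t0[of "x i" "y i"] by metis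
  then show "\<exists>U. open U \<and> \<not> (x \<in> U \<longleftrightarrow> y \<in> U)"
    by (intro exI[of _ "(\<lambda>w. w i) -` U"]) (simp add: open_coordinate_vimage)
qed

instance "fun" :: (type, t1_space) t1_space
proof
  fix x y :: "'a \<Rightarrow> 'b"
  assume "x \<noteq> y"
  then obtain i where "x i \<noteq> y i" by auto
  then obtain U where "open U" "x i \<in> U" "y i \<notin> U"
    using separation_t1[of "x i" "y i"] by metis
  then show "\<exists>U. open U \<and> x \<in> U \<and> y \<notin> U"
    by (intro exI[of _ "(\<lambda>w. w i) -` U"]) (simp add: open_coordinate_vimage)
qed

instance "fun" :: (type, t2_space) t2_space
proof
  fix x y :: "'a \<Rightarrow> 'b"
  assume "x \<noteq> y"
  then obtain i where "x i \<noteq> y i" by auto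
  then obtain U V where "open U" "open V" "x i \<in> U" "y i \<in> V" "U \<inter> V = {}"
    using separation_t2[of "x i" "y i"] by metis
  then show "\<exists>U V. open U \<and> open V \<and> x \<in> U \<and> y \<in> V \<and> U \<inter> V = {}"
    by (intro exI[of _ "(\<lambda>w. w i) -` U"] exI[of _ "(\<lambda>w. w i) -` V"])
      (auto simp: open_coordinate_vimage)
qed

lemma compact_UNIV_fun:
  assumes "compact (UNIV :: 'b::topological_space set)"
  shows "compact (UNIV :: ('i \<Rightarrow> 'b) set)"
proof -
  have "compact_space (product_topology (\<lambda>_ :: 'i. euclidean :: 'b topology) UNIV)"
    using assms unfolding compact_space_product_topology by (simp add: compact_space_def)
  then show ?thesis
    by (simp add: euclidean_product_topology compact_space_def)
qed

lemma normal_space_euclidean_compact: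
  assumes "compact (UNIV :: 'b::t2_space set)"
  shows "normal_space (euclidean :: 'b topology)"
proof -
  have "Hausdorff_space (euclidean :: 'b topology)"
    by (simp add: Hausdorff_space_def disjnt_def) (metis separation_t2)
  then show ?thesis
    using assms by (intro compact_Hausdorff_or_regular_imp_normal_space) (auto simp: compact_space_def)
qed

lemma Tietze_compact:
  fixes f :: "'b::t2_space \<Rightarrow> real"
  assumes "compact (UNIV :: 'b set)" "closed S" "continuous_on S f"
  obtains g where "continuous_on UNIV g" "\<And>x. x \<in> S \<Longrightarrow> g x = f x"
proof -
  have "closedin euclidean S" "continuous_map (top_of_set S) euclidean f"
    using assms(2,3) by simp_all
  then obtain g where "continuous_map euclidean euclidean g" "\<forall>x\<in>S. g x = f x"
    using normal_space_euclidean_compact[OF assms(1)] unfolding normal_space_iff_Tietze by blast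
  then show thesis using that by simp
qed

section \<open>Orbit sums along finite words\<close>

text \<open>
  The word \<open>u\<close> with its \<open>i\<close>-th letter at the origin, padded with an arbitrary letter. An observable
  depending on finitely many coordinates sees the padding only near the ends of \<open>u\<close>.
\<close>

definition embed_word :: "'a list \<Rightarrow> int \<Rightarrow> int \<Rightarrow> 'a" where
  "embed_word u i = (\<lambda>j. if 0 \<le> i + j \<and> i + j < int (length u) then u ! nat (i + j) else undefined)"

definition orbit_sum :: "((int \<Rightarrow> 'a) \<Rightarrow> real) \<Rightarrow> 'a list \<Rightarrow> real" where
  "orbit_sum F u = (\<Sum>i<length u. F (embed_word u (int i)))"

lemma orbit_sum_Nil [simp]: "orbit_sum F [] = 0"
  by (simp add: orbit_sum_def)

lemma shift_embed_word: "shift (embed_word u i) = embed_word u (i + 1)"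
  by (rule ext) (simp add: shift_def embed_word_def add.assoc add.commute[of 1])

lemma shift_pow: "(shift ^^ n) w = (\<lambda>j. w (int n + j))"
  by (induction n) (auto simp: shift_def algebra_simps)

lemma continuous_on_shift: "continuous_on UNIV (shift :: (int \<Rightarrow> 'a::topological_space) \<Rightarrow> _)"
  unfolding shift_def by (intro continuous_on_coordinatewise_then_product continuous_on_product_coordinates)

text \<open>On words of a fixed length, each coordinate of \<open>embed_word\<close> is either the
  letter at a fixed position or the constant padding.\<close>

lemma continuous_on_orbit_sum:
  fixes F :: "(int \<Rightarrow> 'a::topological_space) \<Rightarrow> real"
  assumes "continuous_on UNIV F"
  shows "continuous_on UNIV (orbit_sum F)"
proof (rule continuous_on_wordsI)
  fix n :: nat
  let ?P = "product_topology (\<lambda>_. euclidean :: 'a topology) {..<n}"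
  have "continuous_map ?P euclidean (\<lambda>x. F (embed_word (map x [0..<n]) i))" for i
  proof -
    have "continuous_map ?P euclidean (\<lambda>x. embed_word (map x [0..<n]) i j)" for j
    proof (cases "0 \<le> i + j \<and> i + j < int n")
      case True
      then have "nat (i + j) < n" by linarith
      then have "(\<lambda>x. embed_word (map x [0..<n]) i j) = (\<lambda>x :: nat \<Rightarrow> 'a. x (nat (i + j)))"
        using True by (auto simp: embed_word_def)
      then show ?thesis
        using \<open>nat (i + j) < n\<close> by (auto intro: continuous_map_product_projection)
    next
      case False
      then have "(\<lambda>x. embed_word (map x [0..<n]) i j) = (\<lambda>x :: nat \<Rightarrow> 'a. undefined)"
        by (auto simp: embed_word_def)
      then show ?thesis by simp
    qed
    then have "continuous_map ?P (product_topology (\<lambda>_. euclidean) UNIV) (\<lambda>x. embed_word (map x [0..<n]) i)"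
      by (subst continuous_map_componentwise_UNIV) auto
    moreover have "continuous_map euclidean euclidean F"
      using assms by simp
    ultimately show ?thesis
      using continuous_map_compose[of ?P euclidean "\<lambda>x. embed_word (map x [0..<n]) i" euclidean F]
      by (simp add: euclidean_product_topology o_def)
  qed
  then have "continuous_map ?P euclidean (\<lambda>x. \<Sum>i<n. F (embed_word (map x [0..<n]) (int i)))"
    by (intro continuous_map_sum) auto
  then show "continuous_map ?P euclidean (\<lambda>x. orbit_sum F (map x [0..<n]))"
    by (simp add: orbit_sum_def)
qed

lemma abs_orbit_sum_le:
  assumes "\<And>w. \<bar>F w\<bar> \<le> B"
  shows "\<bar>orbit_sum F u\<bar> \<le> B * real (length u)"
proof -
  have "\<bar>orbit_sum F u\<bar> \<le> (\<Sum>i<length u. B)"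
    unfolding orbit_sum_def by (intro order_trans[OF sum_abs] sum_mono assms)
  then show ?thesis by (simp add: mult.commute)
qed

text \<open>A telescoping sum. For bounded \<open>F\<close> the boundary terms stay bounded while
  words grow, which makes limits of empirical averages shift invariant.\<close>

lemma orbit_sum_shift:
  "orbit_sum (F \<circ> shift) u = orbit_sum F u + F (embed_word u (int (length u))) - F (embed_word u 0)"
proof -
  have "(\<Sum>i<length u. F (embed_word u (int (Suc i))) - F (embed_word u (int i))) =
      F (embed_word u (int (length u))) - F (embed_word u (int 0))"
    by (rule sum_lessThan_telescope)
  then show ?thesis
    by (simp add: orbit_sum_def shift_embed_word sum_subtractf add.commute)
qed

lemma abs_sum_diff_le:
  fixes f g :: "'i \<Rightarrow> real"
  assumes "finite I" "finite E" "card E \<le> k" "0 \<le> c"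
    and "\<And>i. i \<in> I \<Longrightarrow> i \<notin> E \<Longrightarrow> f i = g i" "\<And>i. i \<in> I \<Longrightarrow> \<bar>f i - g i\<bar> \<le> c"
  shows "\<bar>sum f I - sum g I\<bar> \<le> c * k"
proof -
  have "\<bar>sum f I - sum g I\<bar> \<le> (\<Sum>i\<in>I. \<bar>f i - g i\<bar>)"
    unfolding sum_subtractf[symmetric] by (rule sum_abs)
  also have "\<dots> = (\<Sum>i\<in>I \<inter> E. \<bar>f i - g i\<bar>)"
    using assms by (intro sum.mono_neutral_right) auto
  also have "\<dots> \<le> (\<Sum>i\<in>I \<inter> E. c)"
    using assms by (intro sum_mono) auto
  also have "\<dots> = c * card (I \<inter> E)"
    by simp
  also have "\<dots> \<le> c * k"
    using assms card_mono[of E "I \<inter> E"] by (intro mult_left_mono) auto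
  finally show ?thesis .
qed

definition cylinder_function :: "nat \<Rightarrow> ((int \<Rightarrow> 'a) \<Rightarrow> real) \<Rightarrow> bool" where
  "cylinder_function k F \<longleftrightarrow> (\<forall>w w'. (\<forall>j. \<bar>j\<bar> \<le> int k \<longrightarrow> w j = w' j) \<longrightarrow> F w = F w')"

text \<open>Only positions within \<open>k\<close> of the join see different letters: at most
  \<open>k\<close> on each side, each costing at most \<open>2 * B\<close>. The outer ends cost
  nothing, because both sums see the same padding there.\<close>

lemma quasi_additive_orbit_sum:
  assumes F: "cylinder_function k F" and B: "\<And>w. \<bar>F w\<bar> \<le> B"
  shows "quasi_additive (orbit_sum F) (4 * B * real k)"
proof
  fix u v :: "'a list"
  have B0: "0 \<le> B"
    using B[of undefined] by linarith
  have B2: "\<bar>F w - F w'\<bar> \<le> 2 * B" for w w'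
    using B[of w] B[of w'] by linarith
  have split: "orbit_sum F (u @ v) = (\<Sum>i<length u. F (embed_word (u @ v) (int i)))
      + (\<Sum>i<length v. F (embed_word (u @ v) (int (length u + i))))"
  proof -
    have "orbit_sum F (u @ v) = (\<Sum>i<length u + length v. F (embed_word (u @ v) (int i)))"
      by (simp add: orbit_sum_def)
    also have "\<dots> = (\<Sum>i<length u. F (embed_word (u @ v) (int i)))
        + (\<Sum>i\<in>{length u..<length u + length v}. F (embed_word (u @ v) (int i)))"
      by (subst sum.union_disjoint[symmetric]) (auto intro!: sum.cong)
    also have "(\<Sum>i\<in>{length u..<length u + length v}. F (embed_word (u @ v) (int i)))
        = (\<Sum>i<length v. F (embed_word (u @ v) (int (length u + i))))"
      by (rule sum.reindex_bij_witness[of _ "\<lambda>i. length u + i" "\<lambda>i. i - length u"]) auto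
    finally show ?thesis .
  qed
  have "\<bar>(\<Sum>i<length u. F (embed_word (u @ v) (int i))) - orbit_sum F u\<bar> \<le> 2 * B * real k"
    unfolding orbit_sum_def
  proof (rule abs_sum_diff_le[where E = "{length u - k..<length u}"])
    fix i
    assume "i \<in> {..<length u}" "i \<notin> {length u - k..<length u}"
    then have "i + k < length u" by auto
    then have "embed_word (u @ v) (int i) j = embed_word u (int i) j" if "\<bar>j\<bar> \<le> int k" for j
      using that by (auto simp: embed_word_def nth_append)
    then show "F (embed_word (u @ v) (int i)) = F (embed_word u (int i))"
      using F unfolding cylinder_function_def by blast
  qed (use B0 B2 in auto)
  moreover have "\<bar>(\<Sum>i<length v. F (embed_word (u @ v) (int (length u + i)))) - orbit_sum F v\<bar> \<le> 2 * B * real k"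
    unfolding orbit_sum_def
  proof (rule abs_sum_diff_le[where E = "{..<k}"])
    fix i
    assume "i \<in> {..<length v}" "i \<notin> {..<k}"
    then have "embed_word (u @ v) (int (length u + i)) j = embed_word v (int i) j" if "\<bar>j\<bar> \<le> int k" for j
      using that by (auto simp: embed_word_def nth_append nat_less_iff intro!: arg_cong[of _ _ "nth v"])
    then show "F (embed_word (u @ v) (int (length u + i))) = F (embed_word v (int i))"
      using F unfolding cylinder_function_def by blast
  qed (use B0 B2 in auto)
  ultimately show "\<bar>orbit_sum F (u @ v) - orbit_sum F u - orbit_sum F v\<bar> \<le> 4 * B * real k"
    unfolding split by linarith
qed simp

text \<open>Here both ends cost, since the configuration continues where the word is padded: up to
  \<open>k + k\<close> positions, each off by at most \<open>2 * B\<close>.\<close>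

lemma orbit_sum_prefix:
  assumes F: "cylinder_function k F" and B: "\<And>w. \<bar>F w\<bar> \<le> B"
  shows "\<bar>(\<Sum>i<n. F ((shift ^^ i) w)) - orbit_sum F (map (\<lambda>j. w (int j)) [0..<n])\<bar> \<le> 2 * B * real (k + k)"
proof -
  let ?u = "map (\<lambda>j. w (int j)) [0..<n]"
  have B0: "0 \<le> B"
    using B[of undefined] by linarith
  have B2: "\<bar>F w - F w'\<bar> \<le> 2 * B" for w w'
    using B[of w] B[of w'] by linarith
  have "\<bar>(\<Sum>i<n. F ((shift ^^ i) w)) - (\<Sum>i<n. F (embed_word ?u (int i)))\<bar> \<le> 2 * B * real (k + k)"
  proof (rule abs_sum_diff_le[where E = "{..<k} \<union> {n - k..<n}"])
    show "card ({..<k} \<union> {n - k..<n}) \<le> k + k"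
      by (rule order_trans[OF card_Un_le]) simp
    fix i
    assume "i \<in> {..<n}" "i \<notin> {..<k} \<union> {n - k..<n}"
    then have "k \<le> i" "i + k < n" by auto
    then have "(shift ^^ i) w j = embed_word ?u (int i) j" if "\<bar>j\<bar> \<le> int k" for j
      using that by (auto simp: embed_word_def shift_pow nat_less_iff)
    then show "F ((shift ^^ i) w) = F (embed_word ?u (int i))"
      using F unfolding cylinder_function_def by blast
  qed (use B0 B2 in auto)
  then show ?thesis by (simp add: orbit_sum_def)
qed

section \<open>Windows and the subshift as a compact set\<close>

lemma sublist_if_nth_eq:
  assumes "k + length u \<le> length v" "\<And>j. j < length u \<Longrightarrow> u ! j = v ! (k + j)"
  shows "sublist u v"
proof -
  have "u = take (length u) (drop k v)"
    using assms by (intro nth_equalityI) auto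
  moreover have "sublist (take (length u) (drop k v)) v"
    by (metis sublist_drop sublist_order.order_trans sublist_take)
  ultimately show ?thesis by metis
qed

text \<open>Windows grow with \<open>n\<close> and exhaust all factors, so membership in the
  subshift becomes a decreasing sequence of closed conditions, the form in which compactness is
  applied.\<close>

definition window :: "nat \<Rightarrow> (int \<Rightarrow> 'a) \<Rightarrow> 'a list" where
  "window n w = map (\<lambda>j. w (int j - int n)) [0..<2 * n]"

lemma continuous_on_map_coordinates:
  "continuous_on UNIV (\<lambda>w :: 'i \<Rightarrow> 'a::topological_space. map (\<lambda>j. w (f j)) js)"
proof (induction js)
  case (Cons j js)
  have "continuous_on UNIV (\<lambda>w :: 'i \<Rightarrow> 'a. [w (f j)])"
    by (rule continuous_on_compose2[OF continuous_on_singleton_word continuous_on_product_coordinates]) auto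
  from continuous_on_append_words[OF this Cons] show ?case by simp
qed simp

lemma window_mono:
  assumes "n \<le> m"
  shows "sublist (window n w) (window m w)"
  using assms by (intro sublist_if_nth_eq[of "m - n"]) (auto simp: window_def of_nat_diff)

lemma subshift_eq: "subshift \<rho> = {w. \<forall>n. window n w \<in> language \<rho>}"
proof (intro set_eqI iffI)
  fix w
  assume w: "w \<in> subshift \<rho>"
  have "factor (window n w) w" for n
    unfolding factor_def window_def by (rule exI[of _ "- int n"]) simp
  then show "w \<in> {w. \<forall>n. window n w \<in> language \<rho>}"
    using w by (simp add: subshift_def)
next
  fix w
  assume w: "w \<in> {w. \<forall>n. window n w \<in> language \<rho>}"
  have "u \<in> language \<rho>" if fac: "factor u w" for u
  proof -
    obtain i where u: "u = map (\<lambda>j. w (i + int j)) [0..<length u]"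
      using fac unfolding factor_def by blast
    define n where "n = nat \<bar>i\<bar> + length u"
    have n: "- int n \<le> i" "i + int (length u) \<le> int n"
      by (auto simp: n_def)
    have "sublist u (window n w)"
    proof (rule sublist_if_nth_eq[of "nat (i + int n)"])
      show "nat (i + int n) + length u \<le> length (window n w)"
        using n by (simp add: window_def)
      fix j
      assume j: "j < length u"
      then have "u ! j = w (i + int j)"
        by (subst u) simp
      moreover have "nat (i + int n) + j < 2 * n"
        using j n by linarith
      then have "window n w ! (nat (i + int n) + j) = w (i + int j)"
        using n by (simp add: window_def)
      ultimately show "u ! j = window n w ! (nat (i + int n) + j)" by simp
    qed
    then show ?thesis
      using w language_sublist by blast
  qed
  then show "w \<in> subshift \<rho>"
    by (simp add: subshift_def)
qed

lemma closed_window_language: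
  fixes \<rho> :: "'a::topological_space \<Rightarrow> 'a list"
  shows "closed {w. window n w \<in> language \<rho>}"
proof -
  have "closed (window n -` language \<rho>)"
    by (rule closed_vimage) (auto simp: language_def window_def[abs_def] intro: continuous_on_map_coordinates)
  then show ?thesis by (simp add: vimage_def)
qed

lemma closed_subshift:
  fixes \<rho> :: "'a::topological_space \<Rightarrow> 'a list"
  shows "closed (subshift \<rho>)"
proof -
  have "subshift \<rho> = (\<Inter>n. {w. window n w \<in> language \<rho>})"
    by (auto simp: subshift_eq)
  then show ?thesis
    by (simp add: closed_INT closed_window_language)
qed

lemma compact_subshift:
  fixes \<rho> :: "'a::topological_space \<Rightarrow> 'a list"
  assumes "compact (UNIV :: 'a set)"
  shows "compact (subshift \<rho>)"
  using compact_Int_closed[OF compact_UNIV_fun[OF assms] closed_subshift[of \<rho>]] by simp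

lemma shift_mem_subshift:
  assumes "w \<in> subshift \<rho>"
  shows "shift w \<in> subshift \<rho>"
proof -
  have "factor u w" if "factor u (shift w)" for u
  proof -
    obtain i where "u = map (\<lambda>j. shift w (i + int j)) [0..<length u]"
      using \<open>factor u (shift w)\<close> unfolding factor_def by blast
    then show ?thesis
      unfolding factor_def by (intro exI[of _ "i + 1"]) (simp add: shift_def algebra_simps)
  qed
  then show ?thesis
    using assms by (simp add: subshift_def)
qed

lemma embed_word_window:
  assumes "n \<le> i" "i + n \<le> length u"
  shows "sublist (window n (embed_word u (int i))) u"
  using assms by (intro sublist_if_nth_eq[of "i - n"]) (auto simp: window_def embed_word_def intro!: arg_cong[of _ _ "nth u"])

text \<open>A padded word need not lie in the subshift, but its central window lies in the language.
  Configurations with n-th window in the language and \<open>F \<le> - e\<close> form decreasing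
  closed sets with empty intersection, so by compactness one of them is empty.\<close>

lemma nonneg_on_subshift_embed_word:
  fixes \<rho> :: "'a::t2_space \<Rightarrow> 'a list" and F :: "(int \<Rightarrow> 'a) \<Rightarrow> real"
  assumes comp: "compact (UNIV :: 'a set)" and F: "continuous_on UNIV F"
    and pos: "\<And>w. w \<in> subshift \<rho> \<Longrightarrow> 0 \<le> F w" and e: "0 < e"
  obtains n where "\<And>u i. u \<in> language \<rho> \<Longrightarrow> n \<le> i \<Longrightarrow> i + n \<le> length u \<Longrightarrow> - e < F (embed_word u (int i))"
proof -
  define C where "C n = {w. window n w \<in> language \<rho>} \<inter> {w. F w \<le> - e}" for n
  have "closed (F -` {..- e})"
    by (intro closed_vimage closed_atMost F)
  then have closed: "closed (C n)" for n
    unfolding C_def vimage_def atMost_iff mem_Collect_eq by (intro closed_Int closed_window_language)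
  have anti: "C m \<subseteq> C n" if "n \<le> m" for m n
    unfolding C_def using window_mono[OF that] language_sublist by blast
  have "\<exists>n. C n = {}"
  proof (rule ccontr)
    assume ne: "\<nexists>n. C n = {}"
    have "UNIV \<inter> (\<Inter>n\<in>UNIV. C n) \<noteq> {}"
    proof (rule compact_imp_fip_image[OF compact_UNIV_fun[OF comp]])
      fix I :: "nat set"
      assume "finite I"
      then obtain m where "\<And>n. n \<in> I \<Longrightarrow> n \<le> m"
        using Max_ge by blast
      then have "C m \<subseteq> (\<Inter>n\<in>I. C n)"
        using anti by blast
      then show "UNIV \<inter> (\<Inter>n\<in>I. C n) \<noteq> {}"
        using ne by blast
    qed (rule closed)
    then obtain w where "\<And>n. w \<in> C n" by blast
    then have "w \<in> subshift \<rho>" "F w \<le> - e"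
      by (auto simp: C_def subshift_eq)
    then show False
      using pos[of w] e by linarith
  qed
  then obtain n where n: "C n = {}" by blast
  show thesis
  proof (rule that)
    fix u i
    assume "u \<in> language \<rho>" "n \<le> i" "i + n \<le> length u"
    then have "window n (embed_word u (int i)) \<in> language \<rho>"
      using embed_word_window language_sublist by blast
    then show "- e < F (embed_word u (int i))"
      using n unfolding C_def by force
  qed
qed

text \<open>At most \<open>n + n\<close> positions near the ends escape the preceding bound, and
  each contributes at least \<open>- B\<close>; hence \<open>K\<close> does not depend on the
  word.\<close>

lemma orbit_sum_lower_bound:
  fixes \<rho> :: "'a::t2_space \<Rightarrow> 'a list" and F :: "(int \<Rightarrow> 'a) \<Rightarrow> real"
  assumes comp: "compact (UNIV :: 'a set)" and F: "continuous_on UNIV F"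
    and pos: "\<And>w. w \<in> subshift \<rho> \<Longrightarrow> 0 \<le> F w" and e: "0 < e"
  obtains K where "\<And>u. u \<in> language \<rho> \<Longrightarrow> - e * real (length u) - K \<le> orbit_sum F u"
proof -
  obtain n where n: "\<And>u i. u \<in> language \<rho> \<Longrightarrow> n \<le> i \<Longrightarrow> i + n \<le> length u \<Longrightarrow> - e < F (embed_word u (int i))"
    using nonneg_on_subshift_embed_word[OF assms] by metis
  obtain B where B: "0 \<le> B" "\<And>w. \<bar>F w\<bar> \<le> B"
    using compact_bounded_real[OF compact_UNIV_fun[OF comp] F] by auto
  show thesis
  proof (rule that)
    fix u
    assume u: "u \<in> language \<rho>"
    let ?E = "{..<n} \<union> {length u - n..<length u}"
    have "(\<Sum>i<length u. - e - (if i \<in> ?E then B else 0)) \<le> orbit_sum F u"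
      unfolding orbit_sum_def
    proof (rule sum_mono)
      fix i
      assume "i \<in> {..<length u}"
      show "- e - (if i \<in> ?E then B else 0) \<le> F (embed_word u (int i))"
      proof (cases "i \<in> ?E")
        case True
        then show ?thesis
          using B(2)[of "embed_word u (int i)"] e by (simp add: abs_le_iff)
      next
        case False
        then have "- e < F (embed_word u (int i))"
          using \<open>i \<in> {..<length u}\<close> by (intro n u) auto
        then show ?thesis
          by (simp only: False if_False diff_0_right less_imp_le)
      qed
    qed
    moreover have "(\<Sum>i<length u. - e - (if i \<in> ?E then B else 0))
        = - e * real (length u) - B * card ({..<length u} \<inter> ?E)"
    proof -
      have "(\<Sum>i<length u. if i \<in> ?E then B else 0) = B * card ({..<length u} \<inter> ?E)"
        by (subst sum.inter_restrict[symmetric]) auto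
      then show ?thesis
        by (simp only: sum_subtractf sum_constant card_lessThan) simp
    qed
    moreover have "card ({..<length u} \<inter> ?E) \<le> n + n"
    proof -
      have "card ({..<length u} \<inter> ?E) \<le> card ?E"
        by (intro card_mono) auto
      also have "\<dots> \<le> n + n"
        by (rule order_trans[OF card_Un_le]) simp
      finally show ?thesis .
    qed
    then have "B * card ({..<length u} \<inter> ?E) \<le> B * real (n + n)"
      using B(1) by (intro mult_left_mono) auto
    ultimately show "- e * real (length u) - B * real (n + n) \<le> orbit_sum F u"
      by linarith
  qed
qed

section \<open>Invariant measures\<close>

context
  fixes X :: "'x::topological_space set" and \<mu>
  assumes pm: "positive_measure X \<mu>"
begin

lemma positive_measure_add:
  "continuous_on X f \<Longrightarrow> continuous_on X g \<Longrightarrow> \<mu> (\<lambda>x. f x + g x) = \<mu> f + \<mu> g"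
  using pm by (simp add: positive_measure_def cont_funs_def)

lemma positive_measure_scale: "continuous_on X f \<Longrightarrow> \<mu> (\<lambda>x. c * f x) = c * \<mu> f"
  using pm by (simp add: positive_measure_def cont_funs_def)

lemma positive_measure_diff:
  assumes "continuous_on X f" "continuous_on X g"
  shows "\<mu> (\<lambda>x. f x - g x) = \<mu> f - \<mu> g"
proof -
  have "continuous_on X (\<lambda>x. (- 1) * g x)"
    by (intro continuous_intros assms)
  from positive_measure_add[OF assms(1) this] positive_measure_scale[OF assms(2), of "- 1"]
  show ?thesis by simp
qed

lemma positive_measure_mono:
  assumes "continuous_on X f" "continuous_on X g" "\<And>x. x \<in> X \<Longrightarrow> f x \<le> g x"
  shows "\<mu> f \<le> \<mu> g"
proof -
  have "continuous_on X (\<lambda>x. g x - f x)"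
    by (intro continuous_intros assms)
  then have "0 \<le> \<mu> (\<lambda>x. g x - f x)"
    using pm assms(3) by (simp add: positive_measure_def cont_funs_def)
  then show ?thesis
    using positive_measure_diff[OF assms(2,1)] by simp
qed

lemma positive_measure_sum:
  assumes "\<And>i. i < (n :: nat) \<Longrightarrow> continuous_on X (f i)"
  shows "\<mu> (\<lambda>x. \<Sum>i<n. f i x) = (\<Sum>i<n. \<mu> (f i))"
  using assms
proof (induction n)
  case 0
  have "continuous_on X (\<lambda>_. 0 :: real)" by simp
  from positive_measure_scale[OF this, of 0] show ?case by simp
next
  case (Suc n)
  have "continuous_on X (\<lambda>x. \<Sum>i<n. f i x)"
    using Suc.prems by (intro continuous_on_sum) simp
  from positive_measure_add[OF this, of "f n"] Suc show ?case by simp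
qed

lemma positive_measure_const:
  assumes "\<mu> (\<lambda>_. 1) = 1"
  shows "\<mu> (\<lambda>_. c) = c"
  using positive_measure_scale[of "\<lambda>_. 1" c] assms by simp

lemma positive_measure_abs_diff_le:
  assumes one: "\<mu> (\<lambda>_. 1) = 1" and f: "continuous_on X f" and g: "continuous_on X g"
    and le: "\<And>x. x \<in> X \<Longrightarrow> \<bar>f x - g x\<bar> \<le> e"
  shows "\<bar>\<mu> f - \<mu> g\<bar> \<le> e"
proof -
  have diff: "continuous_on X (\<lambda>x. f x - g x)"
    by (intro continuous_intros f g)
  have "\<mu> (\<lambda>_. - e) \<le> \<mu> (\<lambda>x. f x - g x)" "\<mu> (\<lambda>x. f x - g x) \<le> \<mu> (\<lambda>_. e)"
    using le by (auto intro!: positive_measure_mono diff simp: abs_le_iff)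
       (metis add.commute le_diff_eq minus_diff_eq neg_le_iff_le uminus_add_conv_diff)+
  then show ?thesis
    unfolding positive_measure_const[OF one] positive_measure_diff[OF f g] by simp
qed

end

text \<open>By invariance the integral of the n-step Birkhoff sum is \<open>n * \<mu> F\<close>, so
  a uniform estimate on orbits of the subshift is an estimate of \<open>\<mu> F\<close>.\<close>

lemma invariant_probability_average:
  fixes \<rho> :: "'a::topological_space \<Rightarrow> 'a list"
  assumes \<mu>: "invariant_probability (subshift \<rho>) shift \<mu>" and F: "continuous_on UNIV F" and "0 < n"
    and le: "\<And>w. w \<in> subshift \<rho> \<Longrightarrow> \<bar>(\<Sum>i<n. F ((shift ^^ i) w)) - \<beta> * real n\<bar> \<le> e * real n"
  shows "\<bar>\<mu> F - \<beta>\<bar> \<le> e"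
proof -
  have pm: "positive_measure (subshift \<rho>) \<mu>" and one: "\<mu> (\<lambda>_. 1) = 1"
    and inv: "\<And>f. continuous_on (subshift \<rho>) f \<Longrightarrow> \<mu> (f \<circ> shift) = \<mu> f"
    using \<mu> by (auto simp: invariant_probability_def cont_funs_def)
  have cont: "continuous_on UNIV (F \<circ> shift ^^ i)" for i
    by (intro continuous_on_compose continuous_on_funpow continuous_on_shift continuous_on_subset[OF F]) auto
  have contX: "continuous_on (subshift \<rho>) (F \<circ> shift ^^ i)" for i
    by (rule continuous_on_subset[OF cont]) simp
  have inv_pow: "\<mu> (F \<circ> shift ^^ i) = \<mu> F" for i
  proof (induction i)
    case 0
    then show ?case by (simp add: o_def)
  next
    case (Suc i)
    have "F \<circ> shift ^^ Suc i = (F \<circ> shift ^^ i) \<circ> shift"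
      by (simp only: funpow_Suc_right o_assoc)
    then show ?case
      by (simp only: inv[OF contX] Suc)
  qed
  have "\<mu> (\<lambda>w. \<Sum>i<n. (F \<circ> shift ^^ i) w) = real n * \<mu> F"
    by (simp only: positive_measure_sum[OF pm contX] inv_pow sum_constant card_lessThan)
  moreover have contS: "continuous_on (subshift \<rho>) (\<lambda>w. \<Sum>i<n. (F \<circ> shift ^^ i) w)"
    by (rule continuous_on_sum[OF contX])
  have "\<bar>\<mu> (\<lambda>w. \<Sum>i<n. (F \<circ> shift ^^ i) w) - \<mu> (\<lambda>_. \<beta> * real n)\<bar> \<le> e * real n"
    by (rule positive_measure_abs_diff_le[OF pm one contS]) (use le in auto)
  ultimately have "\<bar>real n * (\<mu> F - \<beta>)\<bar> \<le> real n * e"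
    by (simp add: positive_measure_const[OF pm one] algebra_simps)
  then have "real n * \<bar>\<mu> F - \<beta>\<bar> \<le> real n * e"
    by (simp add: abs_mult)
  then show ?thesis
    using \<open>0 < n\<close> by simp
qed

section \<open>Uniqueness via cylinder functions, existence via empirical measures\<close>

lemma cylinder_functions_dense:
  fixes f :: "(int \<Rightarrow> 'a::t2_space) \<Rightarrow> real"
  assumes comp: "compact (UNIV :: 'a set)" and X: "compact X" and f: "continuous_on X f" and e: "0 < e"
  obtains k F where "cylinder_function k F" "continuous_on UNIV F" "\<And>w. w \<in> X \<Longrightarrow> \<bar>f w - F w\<bar> < e"
proof -
  define R where "R = {F :: (int \<Rightarrow> 'a) \<Rightarrow> real. continuous_on UNIV F \<and> (\<exists>k. cylinder_function k F)}"
  have mono: "cylinder_function m F" if "cylinder_function k F" "k \<le> m" for k m and F :: "(int \<Rightarrow> 'a) \<Rightarrow> real"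
    using that unfolding cylinder_function_def by force
  have binop: "\<exists>k. cylinder_function k (\<lambda>w. h (F w) (G w))"
    if "cylinder_function i F" "cylinder_function j G" for i j h and F G :: "(int \<Rightarrow> 'a) \<Rightarrow> real"
  proof -
    have "cylinder_function (max i j) F" "cylinder_function (max i j) G"
      using that by (auto intro: mono)
    then have "cylinder_function (max i j) (\<lambda>w. h (F w) (G w))"
      unfolding cylinder_function_def by metis
    then show ?thesis by blast
  qed
  \<comment> \<open>Stone-Weierstrass for the algebra of continuous functions of finitely many
    coordinates; only separation of points needs an argument.\<close>
  interpret function_ring_on R X
  proof
    show "compact X" by (rule X)
    show "continuous_on X F" if "F \<in> R" for F
      using that by (auto simp: R_def intro: continuous_on_subset)
    show "(\<lambda>x. F x + G x) \<in> R" if "F \<in> R" "G \<in> R" for F G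
      using that binop[of _ F _ G "(+)"] by (auto simp: R_def intro: continuous_on_add)
    show "(\<lambda>x. F x * G x) \<in> R" if "F \<in> R" "G \<in> R" for F G
      using that binop[of _ F _ G "(*)"] by (auto simp: R_def intro: continuous_on_mult)
    show "(\<lambda>_. c) \<in> R" for c
      by (auto simp: R_def cylinder_function_def)
    show "\<exists>F\<in>R. F x \<noteq> F y" if "x \<in> X" "y \<in> X" "x \<noteq> y" for x y
    proof -
      obtain i where i: "x i \<noteq> y i"
        using \<open>x \<noteq> y\<close> by auto
      \<comment> \<open>Tietze extension from a two-point set gives a letter function that separates
        the differing letters.\<close>
      have "closed {x i, y i}" "continuous_on {x i, y i} (\<lambda>a. if a = x i then 0 else 1 :: real)"
        by (auto intro!: continuous_on_finite)
      from Tietze_compact[OF comp this] obtain g where g: "continuous_on UNIV g"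
        "\<And>a. a \<in> {x i, y i} \<Longrightarrow> g a = (if a = x i then 0 else 1 :: real)"
        by metis
      have "(\<lambda>w. g (w i)) \<in> R"
        unfolding R_def cylinder_function_def mem_Collect_eq
      proof (intro conjI exI[of _ "nat \<bar>i\<bar>"] allI impI)
        show "continuous_on UNIV (\<lambda>w. g (w i))"
          by (rule continuous_on_compose2[OF g(1) continuous_on_product_coordinates]) auto
      qed simp
      moreover have "g (x i) \<noteq> g (y i)"
        using i g(2) by auto
      ultimately show ?thesis
        by (intro bexI[of _ "\<lambda>w. g (w i)"]) simp_all
    qed
  qed
  obtain F where "F \<in> R" "\<forall>w\<in>X. \<bar>f w - F w\<bar> < e"
    using Stone_Weierstrass_basic[OF f e] by blast
  then show thesis
    using that unfolding R_def by blast
qed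

text \<open>Reduces uniqueness to the observables whose orbit sums are quasi-additive. Equality of
  the functionals themselves follows because both are extensional.\<close>

lemma invariant_probability_eqI:
  fixes \<rho> :: "'a::t2_space \<Rightarrow> 'a list"
  assumes comp: "compact (UNIV :: 'a set)"
    and \<mu>: "invariant_probability (subshift \<rho>) shift \<mu>" and \<nu>: "invariant_probability (subshift \<rho>) shift \<nu>"
    and eq: "\<And>k F. cylinder_function k F \<Longrightarrow> continuous_on UNIV F \<Longrightarrow> \<mu> F = \<nu> F"
  shows "\<mu> = \<nu>"
proof (rule extensionalityI)
  show "\<mu> \<in> extensional (cont_funs (subshift \<rho>))" "\<nu> \<in> extensional (cont_funs (subshift \<rho>))"
    using \<mu> \<nu> by (auto simp: invariant_probability_def positive_measure_def functional_on_def)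
  fix f
  assume "f \<in> cont_funs (subshift \<rho>)"
  then have f: "continuous_on (subshift \<rho>) f"
    by (simp add: cont_funs_def)
  have pm: "positive_measure (subshift \<rho>) \<mu>" "\<mu> (\<lambda>_. 1) = 1"
    "positive_measure (subshift \<rho>) \<nu>" "\<nu> (\<lambda>_. 1) = 1"
    using \<mu> \<nu> by (auto simp: invariant_probability_def)
  have "\<bar>\<mu> f - \<nu> f\<bar> \<le> e" if e: "0 < e" for e
  proof -
    have e2: "0 < e / 2" using e by simp
    obtain k F where F: "cylinder_function k F" "continuous_on UNIV F"
      "\<And>w. w \<in> subshift \<rho> \<Longrightarrow> \<bar>f w - F w\<bar> < e / 2"
      using cylinder_functions_dense[OF comp compact_subshift[OF comp] f e2] by metis
    have F': "continuous_on (subshift \<rho>) F"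
      by (rule continuous_on_subset[OF F(2)]) simp
    have le: "\<bar>f w - F w\<bar> \<le> e / 2" if "w \<in> subshift \<rho>" for w
      using F(3)[OF that] by simp
    have "\<bar>\<mu> f - \<mu> F\<bar> \<le> e / 2" "\<bar>\<nu> f - \<nu> F\<bar> \<le> e / 2"
      by (rule positive_measure_abs_diff_le[OF pm(1,2) f F' le], assumption)
        (rule positive_measure_abs_diff_le[OF pm(3,4) f F' le], assumption)
    then show ?thesis
      using eq[OF F(1,2)] by linarith
  qed
  then have "\<bar>\<mu> f - \<nu> f\<bar> \<le> 0"
    by (rule field_le_epsilon) simp
  then show "\<mu> f = \<nu> f" by simp
qed

text \<open>
  The averages of all observables along a sequence of words form a sequence in a product of compact
  intervals. A filter refining the sequence along which they converge simultaneously replaces the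
  passage to a subsequence, which is not available for uncountably many observables.
\<close>

lemma empirical_measure:
  fixes \<rho> :: "'a::t2_space \<Rightarrow> 'a list" and u :: "nat \<Rightarrow> 'a list"
  assumes comp: "compact (UNIV :: 'a set)" and u: "\<And>n. u n \<in> language \<rho>"
    and len: "filterlim (\<lambda>n. real (length (u n))) at_top sequentially"
  obtains \<mu> H where "invariant_probability (subshift \<rho>) shift \<mu>" "H \<noteq> bot" "H \<le> sequentially"
    "\<And>F. continuous_on UNIV F \<Longrightarrow> ((\<lambda>n. orbit_sum F (u n) / real (length (u n))) \<longlongrightarrow> \<mu> F) H"
proof -
  note compF = compact_UNIV_fun[OF comp, where 'i = int]
  \<comment> \<open>The value 0 at discontinuous functions makes \<open>\<nu> n\<close> a point of a
    product of compact intervals indexed by all functions.\<close>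
  define \<nu> :: "nat \<Rightarrow> ((int \<Rightarrow> 'a) \<Rightarrow> real) \<Rightarrow> real"
    where "\<nu> n F = (if continuous_on UNIV F then orbit_sum F (u n) / real (length (u n)) else 0)" for n F
  have "\<exists>B\<ge>0. continuous_on UNIV F \<longrightarrow> (\<forall>w. \<bar>F w\<bar> \<le> B)" for F :: "(int \<Rightarrow> 'a) \<Rightarrow> real"
    using compact_bounded_real[OF compF, of F] by (metis UNIV_I order_refl)
  then obtain b :: "((int \<Rightarrow> 'a) \<Rightarrow> real) \<Rightarrow> real"
    where b: "\<And>F. 0 \<le> b F" "\<And>F w. continuous_on UNIV F \<Longrightarrow> \<bar>F w\<bar> \<le> b F"
    by metis
  define K where "K = (\<Pi>\<^sub>E F\<in>UNIV. {- b F..b F})"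
  have "compactin (product_topology (\<lambda>_. euclidean) UNIV) K"
    unfolding K_def compactin_PiE by simp
  then have "compact K"
    by (simp add: euclidean_product_topology)
  have abs_quotient: "\<bar>orbit_sum F (u n) / real (length (u n))\<bar> \<le> b F" if "continuous_on UNIV F" for F n
    using abs_orbit_sum_le[of F "b F" "u n"] b that
    by (cases "u n = []") (simp_all add: divide_le_eq)
  have "\<bar>\<nu> n F\<bar> \<le> b F" for n F
    using abs_quotient[of F n] b(1)[of F] by (cases "continuous_on UNIV F") (simp_all add: \<nu>_def)
  then have "\<nu> n F \<in> {- b F..b F}" for n F
    unfolding atLeastAtMost_iff by (smt (verit))
  then have "\<nu> n \<in> K" for n
    by (simp add: K_def PiE_iff)
  then have "eventually (\<lambda>x. x \<in> K) (filtermap \<nu> sequentially)"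
    by (simp add: eventually_filtermap)
  moreover have "filtermap \<nu> sequentially \<noteq> bot"
    by (simp add: filtermap_bot_iff)
  ultimately obtain m where m: "inf (nhds m) (filtermap \<nu> sequentially) \<noteq> bot"
    using \<open>compact K\<close> unfolding compact_filter by blast
  \<comment> \<open>The cluster point \<open>m\<close> of the averages is pulled back to a filter on
    indices; its non-triviality is exactly that \<open>m\<close> is a cluster point.\<close>
  define H where "H = inf (filtercomap \<nu> (nhds m)) sequentially"
  have "H \<noteq> bot"
  proof
    assume "H = bot"
    then have "eventually (\<lambda>_. False) H" by simp
    then obtain P Q where P: "eventually P (filtercomap \<nu> (nhds m))" and Q: "eventually Q sequentially"
      and PQ: "\<And>n. P n \<Longrightarrow> Q n \<Longrightarrow> False"
      unfolding H_def eventually_inf by blast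
    obtain P' where P': "eventually P' (nhds m)" "\<And>n. P' (\<nu> n) \<Longrightarrow> P n"
      using P unfolding eventually_filtercomap by blast
    have "eventually (\<lambda>y. \<exists>n. y = \<nu> n \<and> Q n) (filtermap \<nu> sequentially)"
      unfolding eventually_filtermap by (rule eventually_mono[OF Q]) blast
    then have "eventually (\<lambda>_. False) (inf (nhds m) (filtermap \<nu> sequentially))"
      unfolding eventually_inf using P' PQ by blast
    then show False
      using m by (simp add: trivial_limit_def)
  qed
  have H: "H \<le> sequentially"
    unfolding H_def by simp
  have "(\<nu> \<longlongrightarrow> m) H"
    unfolding H_def by (rule tendsto_mono[OF inf_le1 filterlim_filtercomap])
  then have \<nu>_lim: "((\<lambda>n. \<nu> n F) \<longlongrightarrow> m F) H" for F
    by (rule continuous_on_tendsto_compose[OF continuous_on_product_coordinates[of F]]) auto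
  have lim: "((\<lambda>n. orbit_sum F (u n) / real (length (u n))) \<longlongrightarrow> m F) H" if "continuous_on UNIV F" for F
    using \<nu>_lim[of F] that by (simp add: \<nu>_def)
  have vanish: "((\<lambda>n. c / real (length (u n))) \<longlongrightarrow> 0) H" for c
    by (rule tendsto_mono[OF H]) (intro tendsto_divide_0[OF tendsto_const] filterlim_at_top_imp_at_infinity len)
  have len_pos: "eventually (\<lambda>n. 0 < length (u n)) H"
    using filter_leD[OF H] filterlim_at_top_dense[THEN iffD1, OF len, rule_format, of 0] by auto
  have uniq: "l = l'" if "(f \<longlongrightarrow> l) H" "(f \<longlongrightarrow> l') H" for f and l l' :: real
    using tendsto_unique[OF \<open>H \<noteq> bot\<close>] that by blast
  have m_add: "m (\<lambda>w. F w + G w) = m F + m G" if F: "continuous_on UNIV F" and G: "continuous_on UNIV G" for F G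
  proof (rule uniq[OF lim])
    show "continuous_on UNIV (\<lambda>w. F w + G w)"
      by (intro continuous_intros F G)
    show "((\<lambda>n. orbit_sum (\<lambda>w. F w + G w) (u n) / real (length (u n))) \<longlongrightarrow> m F + m G) H"
      using tendsto_add[OF lim[OF F] lim[OF G]] by (simp add: orbit_sum_def sum.distrib add_divide_distrib)
  qed
  have m_scale: "m (\<lambda>w. c * F w) = c * m F" if F: "continuous_on UNIV F" for F c
  proof (rule uniq[OF lim])
    show "continuous_on UNIV (\<lambda>w. c * F w)"
      by (intro continuous_intros F)
    show "((\<lambda>n. orbit_sum (\<lambda>w. c * F w) (u n) / real (length (u n))) \<longlongrightarrow> c * m F) H"
      using tendsto_mult_left[OF lim[OF F], of c] by (simp add: orbit_sum_def sum_distrib_left)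
  qed
  have m_one: "m (\<lambda>_. 1) = 1"
  proof (rule uniq[OF lim])
    show "((\<lambda>n. orbit_sum (\<lambda>_. 1) (u n) / real (length (u n))) \<longlongrightarrow> 1) H"
      by (rule tendsto_eventually, rule eventually_mono[OF len_pos]) (simp add: orbit_sum_def)
  qed simp
  \<comment> \<open>Positivity is tested on the subshift only, although \<open>m\<close> acts on
    functions of all configurations. Hence \<open>m F\<close> depends only on the restriction of
    \<open>F\<close> to the subshift.\<close>
  have m_pos: "0 \<le> m F" if F: "continuous_on UNIV F" and pos: "\<And>w. w \<in> subshift \<rho> \<Longrightarrow> 0 \<le> F w" for F
  proof (rule field_le_epsilon)
    fix e :: real
    assume e: "0 < e"
    obtain C where C: "\<And>v. v \<in> language \<rho> \<Longrightarrow> - e * real (length v) - C \<le> orbit_sum F v"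
      using orbit_sum_lower_bound[OF comp F pos e] by metis
    have "- e - 0 \<le> m F"
    proof (rule tendsto_le[OF \<open>H \<noteq> bot\<close> lim[OF F]])
      show "((\<lambda>n. - e - C / real (length (u n))) \<longlongrightarrow> - e - 0) H"
        by (intro tendsto_intros vanish)
      show "eventually (\<lambda>n. - e - C / real (length (u n)) \<le> orbit_sum F (u n) / real (length (u n))) H"
      proof (rule eventually_mono[OF len_pos])
        fix n
        assume "0 < length (u n)"
        moreover have "(- e * real (length (u n)) - C) / real (length (u n))
            \<le> orbit_sum F (u n) / real (length (u n))"
          by (intro divide_right_mono C u) simp
        ultimately show "- e - C / real (length (u n)) \<le> orbit_sum F (u n) / real (length (u n))"
          by (simp add: diff_divide_distrib)
      qed
    qed
    then show "0 \<le> m F + e" by simp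
  qed
  have m_shift: "m (F \<circ> shift) = m F" if F: "continuous_on UNIV F" for F
  proof (rule uniq[OF lim])
    show "continuous_on UNIV (F \<circ> shift)"
      by (intro continuous_on_compose continuous_on_shift continuous_on_subset[OF F]) auto
    let ?r = "\<lambda>n. (F (embed_word (u n) (int (length (u n)))) - F (embed_word (u n) 0)) / real (length (u n))"
    have "(?r \<longlongrightarrow> 0) H"
    proof (rule Lim_null_comparison[OF _ vanish[of "2 * b F"]])
      have "\<bar>F w - F w'\<bar> \<le> 2 * b F" for w w'
        using b(2)[OF F, of w] b(2)[OF F, of w'] by linarith
      then show "eventually (\<lambda>n. norm (?r n) \<le> 2 * b F / real (length (u n))) H"
        by (intro always_eventually allI) (auto intro!: divide_right_mono)
    qed
    from tendsto_add[OF lim[OF F] this]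
    show "((\<lambda>n. orbit_sum (F \<circ> shift) (u n) / real (length (u n))) \<longlongrightarrow> m F) H"
      by (simp add: orbit_sum_shift diff_divide_distrib add_divide_distrib algebra_simps)
  qed
  have m_mono: "m F \<le> m G" if F: "continuous_on UNIV F" and G: "continuous_on UNIV G"
    and le: "\<And>w. w \<in> subshift \<rho> \<Longrightarrow> F w \<le> G w" for F G
  proof -
    have nF: "continuous_on UNIV (\<lambda>w. - 1 * F w)"
      by (intro continuous_intros F)
    have "0 \<le> m (\<lambda>w. G w + - 1 * F w)"
      by (rule m_pos) (use le in \<open>auto intro!: continuous_intros F G\<close>)
    then show ?thesis
      unfolding m_add[OF G nF] m_scale[OF F] by simp
  qed
  \<comment> \<open>Any Tietze extension will do, since \<open>m_mono\<close> gives all of them the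
    same value.\<close>
  define ext where "ext f = (SOME F. continuous_on UNIV F \<and> (\<forall>w\<in>subshift \<rho>. F w = f w))"
    for f :: "(int \<Rightarrow> 'a) \<Rightarrow> real"
  have ext: "continuous_on UNIV (ext f) \<and> (\<forall>w\<in>subshift \<rho>. ext f w = f w)"
    if "continuous_on (subshift \<rho>) f" for f
  proof -
    have "\<exists>F. continuous_on UNIV F \<and> (\<forall>w\<in>subshift \<rho>. F w = f w)"
      using Tietze_compact[OF compF closed_subshift that] by metis
    then show ?thesis
      unfolding ext_def by (rule someI_ex)
  qed
  define \<mu> where "\<mu> = restrict (\<lambda>f. m (ext f)) (cont_funs (subshift \<rho>))"
  have \<mu>_eq: "\<mu> f = m F" if "continuous_on (subshift \<rho>) f" "continuous_on UNIV F"
    "\<And>w. w \<in> subshift \<rho> \<Longrightarrow> F w = f w" for f F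
    using that ext[OF that(1)]
    by (auto simp: \<mu>_def cont_funs_def intro!: antisym m_mono)
  have \<mu>_UNIV: "\<mu> F = m F" if "continuous_on UNIV F" for F
    using that by (intro \<mu>_eq continuous_on_subset[OF that]) auto
  have "invariant_probability (subshift \<rho>) shift \<mu>"
    unfolding invariant_probability_def positive_measure_def functional_on_def
  proof (intro conjI ballI allI impI)
    show "\<mu> \<in> extensional (cont_funs (subshift \<rho>))"
      by (simp add: \<mu>_def)
    show "\<mu> (\<lambda>_. 1) = 1"
      using m_one by (simp add: \<mu>_UNIV)
    fix f
    assume "f \<in> cont_funs (subshift \<rho>)"
    then have f: "continuous_on (subshift \<rho>) f"
      by (simp add: cont_funs_def)
    note F = ext[OF f]
    show "\<mu> (\<lambda>x. c * f x) = c * \<mu> f" for c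
    proof -
      have "\<mu> (\<lambda>x. c * f x) = m (\<lambda>x. c * ext f x)"
        by (rule \<mu>_eq) (use F in \<open>auto intro!: continuous_intros f\<close>)
      then show ?thesis
        using F f by (simp add: m_scale \<mu>_def cont_funs_def)
    qed
    show "0 \<le> \<mu> f" if "\<forall>x\<in>subshift \<rho>. 0 \<le> f x"
      using F f that by (auto simp: \<mu>_def cont_funs_def intro!: m_pos)
    show "\<mu> (f \<circ> shift) = \<mu> f"
    proof -
      have "\<mu> (f \<circ> shift) = m (ext f \<circ> shift)"
      proof (rule \<mu>_eq)
        show "continuous_on (subshift \<rho>) (f \<circ> shift)"
          by (intro continuous_on_compose continuous_on_subset[OF continuous_on_shift]
              continuous_on_subset[OF f]) (auto intro: shift_mem_subshift)
        show "continuous_on UNIV (ext f \<circ> shift)"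
          using F by (intro continuous_on_compose continuous_on_shift) (auto intro: continuous_on_subset)
      qed (use F in \<open>auto simp: shift_mem_subshift\<close>)
      then show ?thesis
        using F f by (simp add: m_shift \<mu>_def cont_funs_def)
    qed
    fix g
    assume "g \<in> cont_funs (subshift \<rho>)"
    then have g: "continuous_on (subshift \<rho>) g"
      by (simp add: cont_funs_def)
    note G = ext[OF g]
    show "\<mu> f = \<mu> g" if "\<forall>x\<in>subshift \<rho>. f x = g x"
      using \<mu>_eq[OF f, of "ext g"] \<mu>_eq[OF g, of "ext g"] G that by simp
    show "\<mu> (\<lambda>x. f x + g x) = \<mu> f + \<mu> g"
    proof -
      have "\<mu> (\<lambda>x. f x + g x) = m (\<lambda>x. ext f x + ext g x)"
        by (rule \<mu>_eq) (use F G in \<open>auto intro!: continuous_intros f g\<close>)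
      then show ?thesis
        using F G f g by (simp add: m_add \<mu>_def cont_funs_def)
    qed
  next
    have "\<bar>\<mu> f\<bar> \<le> 1 * (SUP x\<in>subshift \<rho>. \<bar>f x\<bar>)" if "f \<in> cont_funs (subshift \<rho>)" for f
    proof -
      have f: "continuous_on (subshift \<rho>) f"
        using that by (simp add: cont_funs_def)
      define s where "s = (SUP x\<in>subshift \<rho>. \<bar>f x\<bar>)"
      note F = ext[OF f]
      have "compact ((\<lambda>x. \<bar>f x\<bar>) ` subshift \<rho>)"
        by (intro compact_continuous_image continuous_intros f compact_subshift comp)
      then have "bdd_above ((\<lambda>x. \<bar>f x\<bar>) ` subshift \<rho>)"
        by (rule bounded_imp_bdd_above[OF compact_imp_bounded])
      then have "\<bar>f x\<bar> \<le> s" if "x \<in> subshift \<rho>" for x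
        unfolding s_def using that by (rule cSUP_upper[rotated])
      then have s: "ext f x \<le> s" "- s \<le> ext f x" if "x \<in> subshift \<rho>" for x
        using F that by (auto simp: abs_le_iff minus_le_iff)
      have const: "m (\<lambda>_. c) = c" for c
        using m_scale[of "\<lambda>_. 1" c] m_one by simp
      have "m (ext f) \<le> m (\<lambda>_. s)" "m (\<lambda>_. - s) \<le> m (ext f)"
        using F s by (auto intro!: m_mono)
      then have "\<bar>m (ext f)\<bar> \<le> s"
        unfolding const by linarith
      then show ?thesis
        using f by (simp add: \<mu>_def cont_funs_def s_def)
    qed
    then show "\<exists>B. \<forall>f\<in>cont_funs (subshift \<rho>). \<bar>\<mu> f\<bar> \<le> B * (SUP x\<in>subshift \<rho>. \<bar>f x\<bar>)"
      by blast
  qed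
  moreover have "((\<lambda>n. orbit_sum F (u n) / real (length (u n))) \<longlongrightarrow> \<mu> F) H" if "continuous_on UNIV F" for F
    using lim[OF that] \<mu>_UNIV[OF that] by simp
  ultimately show thesis
    using that \<open>H \<noteq> bot\<close> H by blast
qed

section \<open>Power convergence and unique ergodicity\<close>

context irreducible_substitution
begin

abbreviation M :: "('a \<Rightarrow>\<^sub>C real) \<Rightarrow> ('a \<Rightarrow>\<^sub>C real)" where
  "M \<equiv> subst_operator \<rho>"

abbreviation T :: "('a \<Rightarrow>\<^sub>C real) \<Rightarrow> ('a \<Rightarrow>\<^sub>C real)" where
  "T \<equiv> normalised_operator \<rho>"

abbreviation r :: real where
  "r \<equiv> spectral_radius M"

lemma bounded_linear_M: "bounded_linear M"
  by (rule bounded_linear_subst_operator[OF compact_alphabet continuous_subst])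

lemma M_pow: "apply_bcontfun ((M ^^ n) f) a = (\<Sum>b\<leftarrow>iter n [a]. apply_bcontfun f b)"
  by (rule apply_subst_operator_pow[OF compact_alphabet continuous_subst])

lemma M_pow_one: "apply_bcontfun ((M ^^ n) (const_bcontfun 1)) a = real (length (iter n [a]))"
  by (simp add: M_pow sum_list_triv)

lemma M_pow_scale: "(M ^^ n) (c *\<^sub>R f) = c *\<^sub>R (M ^^ n) f"
  by (rule bcontfun_eqI) (simp add: M_pow sum_list_const_mult)

lemma M_mono:
  assumes "\<And>b. apply_bcontfun f b \<le> apply_bcontfun g b"
  shows "apply_bcontfun ((M ^^ n) f) a \<le> apply_bcontfun ((M ^^ n) g) a"
  unfolding M_pow by (intro sum_list_mono assms)

lemma norm_M_pow_le:
  assumes "\<And>a. real (length (iter n [a])) \<le> K"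
  shows "norm ((M ^^ n) f) \<le> K * norm f"
proof (rule norm_bound)
  fix a
  have "norm (apply_bcontfun ((M ^^ n) f) a) \<le> (\<Sum>b\<leftarrow>iter n [a]. \<bar>apply_bcontfun f b\<bar>)"
    using sum_list_abs[of "map (apply_bcontfun f) (iter n [a])"] by (simp add: M_pow o_def)
  also have "\<dots> \<le> (\<Sum>b\<leftarrow>iter n [a]. norm f)"
    using norm_bounded[of f] by (intro sum_list_mono) auto
  also have "\<dots> = real (length (iter n [a])) * norm f"
    by (simp add: sum_list_triv)
  also have "\<dots> \<le> K * norm f"
    by (intro mult_right_mono assms) simp
  finally show "norm (apply_bcontfun ((M ^^ n) f) a) \<le> K * norm f" .
qed

lemma T_pow: "(T ^^ n) f = (1 / r ^ n) *\<^sub>R (M ^^ n) f"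
proof (induction n)
  case (Suc n)
  have "(T ^^ Suc n) f = (1 / r) *\<^sub>R M ((1 / r ^ n) *\<^sub>R (M ^^ n) f)"
    by (simp add: Suc normalised_operator_def)
  also have "\<dots> = (1 / r ^ Suc n) *\<^sub>R (M ^^ Suc n) f"
    using M_pow_scale[of 1] by simp
  finally show ?case .
qed simp

section \<open>Natural length functions and growth of lengths\<close>

lemma natural_length_function_pos:
  assumes l: "natural_length_function \<rho> l"
  shows "0 < apply_bcontfun l a"
proof (rule ccontr)
  assume "\<not> 0 < apply_bcontfun l a"
  obtain c where nonneg: "\<And>b. 0 \<le> apply_bcontfun l b" and c: "M l = c *\<^sub>R l"
    using l unfolding natural_length_function_def by blast
  \<comment> \<open>At a zero of \<open>l\<close> the eigenvalue equation makes a sum of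
    non-negative terms vanish, so \<open>l\<close> is zero on all letters of the image.\<close>
  have "{b. apply_bcontfun l b = 0} = UNIV"
  proof (rule invariant_closed_set)
    show "closed {b. apply_bcontfun l b = 0}"
      by (intro closed_Collect_eq continuous_on_apply_bcontfun continuous_on_const)
    show "{b. apply_bcontfun l b = 0} \<noteq> {}"
      using \<open>\<not> 0 < apply_bcontfun l a\<close> nonneg[of a] by force
    fix a b
    assume "a \<in> {b. apply_bcontfun l b = 0}" and b: "b \<in> set (\<rho> a)"
    then have "(\<Sum>b\<leftarrow>\<rho> a. apply_bcontfun l b) = 0"
      using arg_cong[OF c, of "\<lambda>f. apply_bcontfun f a"]
      by (simp add: apply_subst_operator[OF compact_alphabet continuous_subst])
    then have "\<forall>x\<in>set (map (apply_bcontfun l) (\<rho> a)). x = 0"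
      by (subst (asm) sum_list_nonneg_eq_0_iff) (auto simp: nonneg)
    then show "b \<in> {b. apply_bcontfun l b = 0}"
      using b by simp
  qed
  then have "apply_bcontfun l b = 0" for b by blast
  then have "l = 0"
    by (intro bcontfun_eqI) simp
  then show False
    using l by (simp add: natural_length_function_def)
qed

text \<open>
  Since \<open>\<ell>\<close> is bounded above and away from \<open>0\<close>, the identity \<open>M\<^sup>n \<ell> = \<lambda>\<^sup>n \<ell>\<close> makes all lengths
  grow like \<open>\<lambda>\<^sup>n\<close>, which forces \<open>\<lambda>\<close> to be the spectral radius.
\<close>

lemma natural_length_function_growth:
  assumes l: "natural_length_function \<rho> l"
  obtains m C where "0 < m" "0 < C" "1 < r" "M l = r *\<^sub>R l"
    "\<And>n a. m * r ^ n \<le> real (length (iter n [a]))" "\<And>n a. real (length (iter n [a])) \<le> C * r ^ n"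
proof -
  obtain c where c0: "0 \<le> c" and c: "M l = c *\<^sub>R l" and "l \<noteq> 0"
    using l unfolding natural_length_function_def by blast
  note pos = natural_length_function_pos[OF l]
  obtain a0 where a0: "\<And>b. apply_bcontfun l a0 \<le> apply_bcontfun l b"
    using continuous_attains_inf[OF compact_alphabet, of "apply_bcontfun l"] by auto
  define d where "d = apply_bcontfun l a0"
  have d: "0 < d" "\<And>b. d \<le> apply_bcontfun l b"
    using pos a0 by (auto simp: d_def)
  have up: "apply_bcontfun l b \<le> norm l" for b
    using norm_bounded[of l b] by simp
  have dl: "0 < norm l"
    using d up order_trans less_le_trans by blast
  have "(M ^^ n) l = c ^ n *\<^sub>R l" for n
  proof (induction n)
    case (Suc n)
    have "(M ^^ Suc n) l = M (c ^ n *\<^sub>R l)"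
      by (simp add: Suc)
    also have "\<dots> = c ^ Suc n *\<^sub>R l"
      using M_pow_scale[of 1 "c ^ n" l] c by (simp add: mult.commute)
    finally show ?case .
  qed simp
  then have pow: "(\<Sum>b\<leftarrow>iter n [a]. apply_bcontfun l b) = c ^ n * apply_bcontfun l a" for n a
    using M_pow[of n l a] by simp
  have lower: "c ^ n * d \<le> real (length (iter n [a])) * norm l" for n a
  proof -
    have "c ^ n * d \<le> c ^ n * apply_bcontfun l a"
      using c0 d by (intro mult_left_mono) auto
    also have "\<dots> \<le> (\<Sum>b\<leftarrow>iter n [a]. norm l)"
      unfolding pow[symmetric] by (intro sum_list_mono up)
    finally show ?thesis by (simp add: sum_list_triv)
  qed
  have upper: "real (length (iter n [a])) * d \<le> c ^ n * norm l" for n a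
  proof -
    have "real (length (iter n [a])) * d = (\<Sum>b\<leftarrow>iter n [a]. d)"
      by (simp add: sum_list_triv)
    also have "\<dots> \<le> c ^ n * apply_bcontfun l a"
      unfolding pow[symmetric] by (intro sum_list_mono d)
    also have "\<dots> \<le> c ^ n * norm l"
      using c0 up by (intro mult_left_mono) auto
    finally show ?thesis .
  qed
  \<comment> \<open>Otherwise \<open>upper\<close> would bound all lengths by
    \<open>norm l / d\<close>, against the existence of arbitrarily long words.\<close>
  have "1 < c"
  proof (rule ccontr)
    assume "\<not> 1 < c"
    then have "c ^ n \<le> 1" for n
      using c0 by (simp add: power_le_one)
    then have "c ^ n * norm l \<le> norm l" for n
      using mult_right_mono[of "c ^ n" 1 "norm l"] by simp
    then have bound: "real (length (iter n [a])) \<le> norm l / d" for n a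
      using order_trans[OF upper[of n a]] d by (simp add: pos_le_divide_eq)
    obtain k where "norm l / d < real k"
      using reals_Archimedean2 by blast
    moreover obtain n a where "k \<le> length (iter n [a])"
      using subst unfolding substitution_def by blast
    ultimately show False
      using bound[of n a] by linarith
  qed
  have len_le: "real (length (iter n [a])) \<le> norm l / d * c ^ n" for n a
    using upper[of n a] d by (simp add: field_simps)
  \<comment> \<open>The powers of \<open>M\<close> grow at most like \<open>c ^ n\<close>, so no
    spectral value exceeds \<open>c\<close> in modulus; the eigenvalue \<open>c\<close> attains the
    bound.\<close>
  have "cmod z \<le> c" if "z \<in> spectrum M" for z
  proof (rule cmod_le_of_mem_spectrum[OF bounded_linear_M _ _ c0 that])
    show "norm ((M ^^ n) f) \<le> norm l / d * c ^ n * norm f" for n f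
      by (rule norm_M_pow_le[OF len_le])
  qed (use d in simp)
  moreover have "complex_of_real c \<in> spectrum M"
    by (rule eigenvalue_mem_spectrum[OF bounded_linear.linear[OF bounded_linear_M] c \<open>l \<noteq> 0\<close>])
  then have "c \<in> cmod ` spectrum M"
    using c0 by (intro image_eqI[of _ _ "complex_of_real c"]) auto
  ultimately have r: "r = c"
    unfolding spectral_radius_def by (intro cSup_eq_maximum) auto
  show thesis
  proof (rule that)
    show "0 < d / norm l" "0 < norm l / d" "1 < r" "M l = r *\<^sub>R l"
      using d dl c \<open>1 < c\<close> by (simp_all add: r)
    show "d / norm l * r ^ n \<le> real (length (iter n [a]))" for n a
      using lower[of n a] dl by (simp add: r field_simps)
    show "real (length (iter n [a])) \<le> norm l / d * r ^ n" for n a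
      unfolding r by (rule len_le)
  qed
qed

lemma uniform_growth_of_length_function:
  assumes "natural_length_function \<rho> l"
  shows uniform_growth
  unfolding uniform_growth_def
proof
  fix k
  obtain m where m: "0 < m" "1 < r" "\<And>n a. m * r ^ n \<le> real (length (iter n [a]))"
    using natural_length_function_growth[OF assms] by metis
  obtain N where N: "real k / m < r ^ N"
    using real_arch_pow[OF m(2)] by blast
  have "k \<le> length (iter n [a])" if "N \<le> n" for n a
  proof -
    have "real k \<le> m * r ^ N"
      using N m(1) by (simp add: field_simps)
    also have "\<dots> \<le> real (length (iter N [a]))"
      by (rule m(3))
    also have "\<dots> \<le> real (length (iter n [a]))"
      using length_iter_mono[OF that] by simp
    finally show ?thesis by simp
  qed
  then show "\<exists>N. \<forall>n\<ge>N. \<forall>a. k \<le> length (iter n [a])" by blast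
qed

section \<open>Letter frequencies and unique ergodicity\<close>

lemma invariant_probability_exists: "\<exists>\<mu>. invariant_probability (subshift \<rho>) shift \<mu>"
proof -
  have "\<exists>u\<in>language \<rho>. n \<le> length u" for n
    using subst funpow_extend_subst_mem_language unfolding substitution_def by metis
  then obtain u where u: "\<And>n. u n \<in> language \<rho>" "\<And>n. n \<le> length (u n)"
    by metis
  have "filterlim (\<lambda>n. real (length (u n))) at_top sequentially"
    by (rule filterlim_at_top_mono[OF filterlim_real_sequentially]) (use u(2) in auto)
  then show ?thesis
    by (rule empirical_measure[OF compact_alphabet u(1)]) (rule exI)
qed

text \<open>The average \<open>\<beta>\<close> is common to all orbits of the subshift, so both
  measures give \<open>F\<close> a value within \<open>e / 2\<close> of it. It may depend on
  \<open>e\<close>, as it only serves to compare \<open>\<mu>\<close> with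
  \<open>\<nu>\<close>.\<close>

lemma uniquely_ergodic_if_letter_frequencies:
  assumes freq: letter_frequencies and growth: uniform_growth
  shows "uniquely_ergodic (subshift \<rho>) shift"
proof -
  have "\<mu> = \<nu>" if \<mu>: "invariant_probability (subshift \<rho>) shift \<mu>"
    and \<nu>: "invariant_probability (subshift \<rho>) shift \<nu>" for \<mu> \<nu>
  proof (rule invariant_probability_eqI[OF compact_alphabet \<mu> \<nu>])
    fix k and F :: "(int \<Rightarrow> 'a) \<Rightarrow> real"
    assume cyl: "cylinder_function k F" and F: "continuous_on UNIV F"
    obtain B where B: "\<And>w. \<bar>F w\<bar> \<le> B"
      using compact_bounded_real[OF compact_UNIV_fun[OF compact_alphabet] F] by auto
    define K where "K = 2 * B * real (k + k)"
    have "\<bar>\<mu> F - \<nu> F\<bar> \<le> e" if e: "0 < e" for e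
    proof -
      have e4: "0 < e / 4" using e by simp
      obtain \<beta> N where \<beta>: "\<And>u. u \<in> language \<rho> \<Longrightarrow> N \<le> length u \<Longrightarrow>
          \<bar>orbit_sum F u - \<beta> * real (length u)\<bar> \<le> e / 4 * real (length u)"
        using quasi_additive_average[OF freq growth continuous_on_orbit_sum[OF F]
            quasi_additive_orbit_sum[OF cyl B] e4] by metis
      obtain n0 where n0: "4 * K / e \<le> real n0"
        using real_arch_simple by blast
      \<comment> \<open>\<open>N\<close> is for the average over words, \<open>n0\<close> makes the
        end correction \<open>K\<close> at most \<open>e / 4 * n\<close>, and 1 keeps
        \<open>n\<close> positive.\<close>
      define n where "n = max 1 (max N n0)"
      have n: "0 < n" "N \<le> n" "4 * K / e \<le> real n"
        using n0 by (auto simp: n_def)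
      have "\<bar>(\<Sum>i<n. F ((shift ^^ i) w)) - \<beta> * real n\<bar> \<le> e / 2 * real n" if w: "w \<in> subshift \<rho>" for w
      proof -
        let ?u = "map (\<lambda>j. w (int j)) [0..<n]"
        have "factor ?u w"
          unfolding factor_def by (rule exI[of _ 0]) simp
        then have "?u \<in> language \<rho>"
          using w unfolding subshift_def by blast
        then have "\<bar>orbit_sum F ?u - \<beta> * real n\<bar> \<le> e / 4 * real n"
          using \<beta>[of ?u] n by simp
        moreover have "\<bar>(\<Sum>i<n. F ((shift ^^ i) w)) - orbit_sum F ?u\<bar> \<le> K"
          unfolding K_def by (rule orbit_sum_prefix[OF cyl B])
        moreover have "K \<le> e / 4 * real n"
          using n(3) e by (simp add: field_simps)
        ultimately show ?thesis by linarith
      qed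
      note avg = this
      have "\<bar>\<mu> F - \<beta>\<bar> \<le> e / 2" "\<bar>\<nu> F - \<beta>\<bar> \<le> e / 2"
        by (rule invariant_probability_average[OF \<mu> F n(1) avg], assumption)
          (rule invariant_probability_average[OF \<nu> F n(1) avg], assumption)
      then show ?thesis by linarith
    qed
    then have "\<bar>\<mu> F - \<nu> F\<bar> \<le> 0"
      by (rule field_le_epsilon) simp
    then show "\<mu> F = \<nu> F" by simp
  qed
  then show ?thesis
    unfolding uniquely_ergodic_def using invariant_probability_exists by blast
qed

lemma letter_frequencies_if_uniquely_ergodic:
  assumes growth: uniform_growth and erg: "uniquely_ergodic (subshift \<rho>) shift"
  shows letter_frequencies
  unfolding letter_frequencies_def
proof (intro allI impI)
  fix f :: "'a \<Rightarrow> real"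
  assume f: "continuous_on UNIV f"
  \<comment> \<open>Reading only the origin, \<open>F\<close> has the plain letter sum as orbit sum,
    with no effect of the padding.\<close>
  define F where "F w = f (w (0 :: int))" for w
  have F: "continuous_on UNIV F"
    unfolding F_def by (rule continuous_on_compose2[OF f continuous_on_product_coordinates]) auto
  have sum_F: "orbit_sum F u = (\<Sum>x\<leftarrow>u. f x)" for u
    by (simp add: orbit_sum_def F_def embed_word_def sum_list_sum_nth atLeast0LessThan)
  obtain \<mu> where \<mu>: "\<And>\<nu>. invariant_probability (subshift \<rho>) shift \<nu> \<Longrightarrow> \<nu> = \<mu>"
    using erg unfolding uniquely_ergodic_def by blast
  \<comment> \<open>Proved for every long word of the language; \<open>uniform_growth\<close> then
    makes all \<open>iter q [b]\<close> long at once.\<close>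
  have lang: "\<exists>N. \<forall>u\<in>language \<rho>. N \<le> length u \<longrightarrow>
      \<bar>(\<Sum>x\<leftarrow>u. f x) - \<mu> F * real (length u)\<bar> \<le> e * real (length u)" if e: "0 < e" for e
  proof (rule ccontr)
    assume contra: "\<not> ?thesis"
    have "\<exists>u\<in>language \<rho>. N \<le> length u \<and>
        e * real (length u) < \<bar>(\<Sum>x\<leftarrow>u. f x) - \<mu> F * real (length u)\<bar>" for N
      using contra by (meson not_le)
    then obtain u where u: "\<And>n. u n \<in> language \<rho>" "\<And>n. n \<le> length (u n)"
      "\<And>n. e * real (length (u n)) < \<bar>orbit_sum F (u n) - \<mu> F * real (length (u n))\<bar>"
      unfolding sum_F by metis
    have "filterlim (\<lambda>n. real (length (u n))) at_top sequentially"
      by (rule filterlim_at_top_mono[OF filterlim_real_sequentially]) (use u(2) in auto)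
    then show False
    proof (rule empirical_measure[OF compact_alphabet u(1)])
      fix \<nu> H
      assume \<nu>: "invariant_probability (subshift \<rho>) shift \<nu>" and H: "H \<noteq> bot"
        and lim: "\<And>F. continuous_on UNIV F \<Longrightarrow>
          ((\<lambda>n. orbit_sum F (u n) / real (length (u n))) \<longlongrightarrow> \<nu> F) H"
      have "eventually (\<lambda>n. dist (orbit_sum F (u n) / real (length (u n))) (\<mu> F) < e) H"
        using tendstoD[OF lim[OF F] e] \<mu>[OF \<nu>] by simp
      moreover have "\<not> dist (orbit_sum F (u n) / real (length (u n))) (\<mu> F) < e" for n
      proof
        assume close: "dist (orbit_sum F (u n) / real (length (u n))) (\<mu> F) < e"
        have "u n \<noteq> []"
          using u(3)[of n] by auto
        then have "\<bar>orbit_sum F (u n) - \<mu> F * real (length (u n))\<bar>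
            = \<bar>orbit_sum F (u n) / real (length (u n)) - \<mu> F\<bar> * real (length (u n))"
          by (simp add: abs_mult_pos left_diff_distrib)
        also have "\<dots> \<le> e * real (length (u n))"
          using close by (intro mult_right_mono) (auto simp: dist_real_def)
        finally show False
          using u(3)[of n] by simp
      qed
      ultimately have "eventually (\<lambda>_. False) H"
        by (auto elim: eventually_mono)
      then show False
        using H by (simp add: trivial_limit_def)
    qed
  qed
  show "\<exists>c. \<forall>e>0. \<exists>Q. \<forall>q\<ge>Q. \<forall>b. \<bar>(\<Sum>x\<leftarrow>iter q [b]. f x) - c * real (length (iter q [b]))\<bar>
      \<le> e * real (length (iter q [b]))"
  proof (intro exI[of _ "\<mu> F"] allI impI)
    fix e :: real
    assume "0 < e"
    then obtain N where N: "\<And>u. u \<in> language \<rho> \<Longrightarrow> N \<le> length u \<Longrightarrow>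
        \<bar>(\<Sum>x\<leftarrow>u. f x) - \<mu> F * real (length u)\<bar> \<le> e * real (length u)"
      using lang by blast
    obtain Q where "\<And>q b. Q \<le> q \<Longrightarrow> N \<le> length (iter q [b])"
      using growth unfolding uniform_growth_def by blast
    then show "\<exists>Q. \<forall>q\<ge>Q. \<forall>b. \<bar>(\<Sum>x\<leftarrow>iter q [b]. f x) - \<mu> F * real (length (iter q [b]))\<bar>
        \<le> e * real (length (iter q [b]))"
      using N[OF funpow_extend_subst_mem_language] by blast
  qed
qed

text \<open>Frequencies only compare \<open>(T ^^ n) f\<close> with a multiple of
  \<open>(T ^^ n) u\<close>. That \<open>(T ^^ n) u\<close> itself converges follows by applying the
  comparison to the fixed point \<open>l\<close>: the multiple cannot be 0, and one can solve for
  \<open>(T ^^ n) u\<close>.\<close>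

lemma strongly_power_convergent_if_letter_frequencies:
  assumes l: "natural_length_function \<rho> l" and freq: letter_frequencies
  shows "strongly_power_convergent T"
proof -
  obtain C where C: "0 < C" "1 < r" "M l = r *\<^sub>R l"
    "\<And>n a. real (length (iter n [a])) \<le> C * r ^ n"
    using natural_length_function_growth[OF l] by metis
  define u :: "'a \<Rightarrow>\<^sub>C real" where "u = const_bcontfun 1"
  have asymp: "\<exists>c. (\<lambda>n. (T ^^ n) f - c *\<^sub>R (T ^^ n) u) \<longlonglongrightarrow> 0" for f
  proof -
    obtain c where c: "\<And>e. 0 < e \<Longrightarrow> \<exists>Q. \<forall>q\<ge>Q. \<forall>b.
        \<bar>(\<Sum>x\<leftarrow>iter q [b]. apply_bcontfun f x) - c * real (length (iter q [b]))\<bar>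
          \<le> e * real (length (iter q [b]))"
      using freq continuous_on_apply_bcontfun[of UNIV f] unfolding letter_frequencies_def by blast
    have "(\<lambda>n. (T ^^ n) f - c *\<^sub>R (T ^^ n) u) \<longlonglongrightarrow> 0"
    proof (rule LIMSEQ_I)
      fix e :: real
      assume e: "0 < e"
      \<comment> \<open>Lengths are at most \<open>C * r ^ q\<close>, so after division by
        \<open>r ^ q\<close> this relative error becomes \<open>e / 2\<close>.\<close>
      then have "0 < e / (2 * C)" using C by simp
      then obtain Q where Q: "\<And>q b. Q \<le> q \<Longrightarrow>
          \<bar>(\<Sum>x\<leftarrow>iter q [b]. apply_bcontfun f x) - c * real (length (iter q [b]))\<bar>
            \<le> e / (2 * C) * real (length (iter q [b]))"
        using c by blast
      have "norm ((T ^^ q) f - c *\<^sub>R (T ^^ q) u - 0) < e" if "Q \<le> q" for q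
      proof -
        have rq: "0 < r ^ q" using C by simp
        have "norm ((T ^^ q) f - c *\<^sub>R (T ^^ q) u) \<le> e / 2"
        proof (rule norm_bound)
          fix b
          have "apply_bcontfun ((T ^^ q) f - c *\<^sub>R (T ^^ q) u) b =
              ((\<Sum>x\<leftarrow>iter q [b]. apply_bcontfun f x) - c * real (length (iter q [b]))) / r ^ q"
            by (simp add: T_pow M_pow_one u_def M_pow[of q f] diff_divide_distrib)
          also have "norm \<dots> = \<bar>(\<Sum>x\<leftarrow>iter q [b]. apply_bcontfun f x) - c * real (length (iter q [b]))\<bar> / r ^ q"
            using rq by simp
          also have "\<dots> \<le> (e / (2 * C) * real (length (iter q [b]))) / r ^ q"
            using rq by (intro divide_right_mono Q that) simp
          also have "\<dots> \<le> (e / (2 * C) * (C * r ^ q)) / r ^ q"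
            using C e rq by (intro divide_right_mono mult_left_mono) auto
          also have "\<dots> = e / 2"
            using C rq by simp
          finally show "norm (apply_bcontfun ((T ^^ q) f - c *\<^sub>R (T ^^ q) u) b) \<le> e / 2" .
        qed
        then show ?thesis using e by simp
      qed
      then show "\<exists>N. \<forall>n\<ge>N. norm ((T ^^ n) f - c *\<^sub>R (T ^^ n) u - 0) < e" by blast
    qed
    then show ?thesis by blast
  qed
  have "T l = l"
    using C by (simp add: normalised_operator_def)
  then have Tl: "(T ^^ n) l = l" for n
    by (induction n) simp_all
  obtain c where c: "(\<lambda>n. l - c *\<^sub>R (T ^^ n) u) \<longlonglongrightarrow> 0"
    using asymp[of l] unfolding Tl by blast
  have "c \<noteq> 0"
  proof
    assume "c = 0"
    then have "l = 0"
      using c LIMSEQ_unique[OF tendsto_const] by fastforce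
    then show False
      using l by (simp add: natural_length_function_def)
  qed
  have "(\<lambda>n. (1 / c) *\<^sub>R (l - (l - c *\<^sub>R (T ^^ n) u))) \<longlonglongrightarrow> (1 / c) *\<^sub>R (l - 0)"
    by (intro tendsto_intros c)
  then have one: "(\<lambda>n. (T ^^ n) u) \<longlonglongrightarrow> (1 / c) *\<^sub>R l"
    using \<open>c \<noteq> 0\<close> by simp
  show ?thesis
    unfolding strongly_power_convergent_def
  proof
    fix f
    obtain d where "(\<lambda>n. (T ^^ n) f - d *\<^sub>R (T ^^ n) u) \<longlonglongrightarrow> 0"
      using asymp by blast
    then have "(\<lambda>n. ((T ^^ n) f - d *\<^sub>R (T ^^ n) u) + d *\<^sub>R (T ^^ n) u) \<longlonglongrightarrow> 0 + d *\<^sub>R (1 / c) *\<^sub>R l"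
      by (intro tendsto_intros one)
    then show "convergent (\<lambda>n. (T ^^ n) f)"
      by (auto simp: convergent_def)
  qed
qed

section \<open>Positivity of the spectral radius and the limit of the powers of
  \<open>T\<close>\<close>

lemma one_le_spectral_radius: "1 \<le> r" and spectrum_nonempty: "spectrum M \<noteq> {}"
proof -
  obtain t where t: "1 \<le> t" "complex_of_real t \<in> spectrum M"
  proof (rule positive_operator_spectrum[OF compact_alphabet bounded_linear_M])
    show "0 \<le> apply_bcontfun (M f) a" if "\<And>b. 0 \<le> apply_bcontfun f b" for f a
      using M_mono[of 0 f 1 a] that M_pow_scale[of 1 0 0] by simp
    \<comment> \<open>This is the absence of empty images.\<close>
    show "1 \<le> apply_bcontfun (M (const_bcontfun 1)) a" for a
      using M_pow_one[of 1 a] length_iter_pos[of 1 a] by (simp add: Suc_le_eq)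
  qed
  then show "spectrum M \<noteq> {}" by blast
  have "cmod (complex_of_real t) \<le> r"
    unfolding spectral_radius_def by (rule cSUP_upper[OF t(2) bdd_above_spectrum[OF bounded_linear_M]])
  then show "1 \<le> r" using t(1) by simp
qed

text \<open>
  If \<open>T\<^sup>N 1 \<le> 1/2\<close> and \<open>s\<^sup>N = 2\<close>, then \<open>u = (\<Sum>k<N. s\<^sup>k T\<^sup>k 1)\<close> satisfies \<open>s T u \<le> u\<close>, so the lengths
  grow at most like \<open>(r/s)\<^sup>n\<close>, and the spectral radius would be at most \<open>r/s\<close>.
\<close>

lemma T_pow_one_not_small:
  assumes N: "0 < N" and small: "\<And>a. apply_bcontfun ((T ^^ N) (const_bcontfun 1)) a \<le> 1 / 2"
  shows False
proof -
  define s where "s = root N 2"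
  have s: "1 < s" "s ^ N = 2"
    using N by (simp_all add: s_def)
  have r: "0 < r" using one_le_spectral_radius by simp
  \<comment> \<open>Merges \<open>s\<close> with the normalisation, so that \<open>q ^ k\<close>
    times \<open>M ^^ k\<close> is \<open>s ^ k\<close> times \<open>T ^^ k\<close>.\<close>
  define q where "q = s / r"
  have q: "0 < q" using s r by (simp add: q_def)
  define one :: "'a \<Rightarrow>\<^sub>C real" where "one = const_bcontfun 1"
  define u where "u = (\<Sum>k<N. q ^ k *\<^sub>R (M ^^ k) one)"
  have u_apply: "apply_bcontfun u a = (\<Sum>k<N. q ^ k * real (length (iter k [a])))" for a
  proof -
    have "apply_bcontfun (\<Sum>k<n. q ^ k *\<^sub>R (M ^^ k) one) a = (\<Sum>k<n. q ^ k * real (length (iter k [a])))" for n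
      by (induction n) (simp_all add: one_def M_pow_one)
    then show ?thesis by (simp add: u_def)
  qed
  have u_ge: "1 \<le> apply_bcontfun u a" for a
  proof -
    have "(\<Sum>k\<in>{0}. q ^ k * real (length (iter k [a]))) \<le> (\<Sum>k<N. q ^ k * real (length (iter k [a])))"
      using N q by (intro sum_mono2) auto
    then show ?thesis by (simp add: u_apply)
  qed
  have M_sum: "M (\<Sum>k<n. g k) = (\<Sum>k<n. M (g k))" for g :: "nat \<Rightarrow> 'a \<Rightarrow>\<^sub>C real" and n
    by (rule linear_sum[OF bounded_linear.linear[OF bounded_linear_M]])
  have "q *\<^sub>R M u = (\<Sum>k<N. q ^ Suc k *\<^sub>R (M ^^ Suc k) one)"
    unfolding u_def M_sum scaleR_sum_right
    using M_pow_scale[of 1] by (intro sum.cong) auto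
  \<comment> \<open>Applying \<open>q M\<close> shifts the sum: the bottom term 1 is lost and a top
    term is gained. The latter is at most 1, since \<open>s ^ N = 2\<close> cancels the bound
    1/2.\<close>
  then have "q *\<^sub>R M u + one = u + q ^ N *\<^sub>R (M ^^ N) one"
    using sum.lessThan_Suc_shift[of "\<lambda>k. q ^ k *\<^sub>R (M ^^ k) one" N]
    by (simp add: u_def add.commute)
  moreover have "q ^ N * apply_bcontfun ((M ^^ N) one) a \<le> 1" for a
    using small[of a] s r by (simp add: T_pow q_def power_divide one_def field_simps)
  ultimately have "q * apply_bcontfun (M u) a + 1 \<le> apply_bcontfun u a + 1" for a
    by (metis add_left_mono one_def const_bcontfun.rep_eq plus_bcontfun.rep_eq real_scaleR_def scaleR_bcontfun.rep_eq)
  then have Mu: "apply_bcontfun (M u) a \<le> apply_bcontfun ((1 / q) *\<^sub>R u) a" for a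
    using q by (simp add: field_simps)
  have pow: "apply_bcontfun ((M ^^ n) u) a \<le> (1 / q) ^ n * apply_bcontfun u a" for n a
  proof (induction n arbitrary: a)
    case (Suc n)
    have "apply_bcontfun ((M ^^ Suc n) u) a \<le> apply_bcontfun ((M ^^ n) ((1 / q) *\<^sub>R u)) a"
      using M_mono[of "M u" "(1 / q) *\<^sub>R u" n a] Mu by (simp add: funpow_swap1)
    also have "\<dots> \<le> (1 / q) * ((1 / q) ^ n * apply_bcontfun u a)"
      unfolding M_pow_scale using Suc[of a] q by (simp add: divide_right_mono)
    finally show ?case by simp
  qed simp
  have "real (length (iter n [a])) \<le> norm u * (1 / q) ^ n" for n a
  proof -
    have "real (length (iter n [a])) \<le> apply_bcontfun ((M ^^ n) u) a"
      unfolding M_pow_one[symmetric] by (rule M_mono) (simp add: u_ge)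
    also have "\<dots> \<le> (1 / q) ^ n * apply_bcontfun u a"
      by (rule pow)
    also have "\<dots> \<le> (1 / q) ^ n * norm u"
      using norm_bounded[of u a] q by (intro mult_left_mono) auto
    finally show ?thesis by (simp add: mult.commute)
  qed
  then have "norm ((M ^^ n) f) \<le> norm u * (1 / q) ^ n * norm f" for n f
    by (rule norm_M_pow_le)
  then have "cmod z \<le> 1 / q" if "z \<in> spectrum M" for z
    using cmod_le_of_mem_spectrum[OF bounded_linear_M _ _ _ that, of "norm u" "1 / q"] q by simp
  \<comment> \<open>Bounding the supremum by \<open>1 / q\<close>, which is
    \<open>r / s < r\<close>, is legitimate because the spectrum is non-empty.\<close>
  then have "r \<le> 1 / q"
    unfolding spectral_radius_def by (intro cSUP_least spectrum_nonempty)
  then show False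
    using s r by (simp add: q_def field_simps)
qed

lemma limit_T_fixed:
  assumes "(\<lambda>n. (T ^^ n) f) \<longlonglongrightarrow> h"
  shows "M h = r *\<^sub>R h"
proof -
  have "bounded_linear T"
    unfolding normalised_operator_def by (intro bounded_linear_const_scaleR bounded_linear_M)
  then have "(\<lambda>n. T ((T ^^ n) f)) \<longlonglongrightarrow> T h"
    using assms by (rule bounded_linear.tendsto)
  moreover have "(\<lambda>n. T ((T ^^ n) f)) \<longlonglongrightarrow> h"
    using LIMSEQ_Suc[OF assms] by simp
  ultimately have "T h = h"
    by (rule LIMSEQ_unique)
  then have "r *\<^sub>R T h = r *\<^sub>R h" by simp
  then show ?thesis
    using one_le_spectral_radius by (simp add: normalised_operator_def)
qed

text \<open>With \<open>t\<close> the maximum of \<open>h / l\<close>, the difference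
  \<open>t l - h\<close> is non-negative with a zero. Were it not identically 0, it would be a
  natural length function, hence strictly positive.\<close>

lemma fixed_point_unique:
  assumes l: "natural_length_function \<rho> l" and Ml: "M l = r *\<^sub>R l" and Mh: "M h = r *\<^sub>R h"
  obtains t where "h = t *\<^sub>R l"
proof -
  note pos = natural_length_function_pos[OF l]
  have cont: "continuous_on UNIV (\<lambda>a. apply_bcontfun h a / apply_bcontfun l a)"
    using pos by (intro continuous_on_divide continuous_on_apply_bcontfun) (auto simp: less_imp_neq[symmetric])
  obtain a where a: "\<And>b. apply_bcontfun h b / apply_bcontfun l b \<le> apply_bcontfun h a / apply_bcontfun l a"
    using continuous_attains_sup[OF compact_alphabet UNIV_not_empty cont] by blast
  define t where "t = apply_bcontfun h a / apply_bcontfun l a"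
  define g where "g = t *\<^sub>R l - h"
  have "g = 0"
  proof (rule ccontr)
    assume "g \<noteq> 0"
    moreover have "0 \<le> apply_bcontfun g b" for b
      using a[of b] pos[of b] by (simp add: g_def t_def pos_divide_le_eq)
    moreover have "M g = r *\<^sub>R g"
      unfolding g_def using bounded_linear.linear[OF bounded_linear_M]
      by (simp add: linear_diff linear_cmul Ml Mh scaleR_diff_right mult.commute)
    moreover have "0 \<le> r" using one_le_spectral_radius by simp
    ultimately have "natural_length_function \<rho> g"
      unfolding natural_length_function_def by blast
    from natural_length_function_pos[OF this, of a] show False
      using pos[of a] by (simp add: g_def t_def)
  qed
  then show thesis
    using that[of t] by (simp add: g_def)
qed

text \<open>The limit of \<open>(T ^^ n) u\<close> is the length function \<open>l\<close>, and
  every other limit is a multiple \<open>t l\<close>. So \<open>(T ^^ n) F - t (T ^^ n) u\<close>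
  tends to 0 in norm, which after multiplication by \<open>r ^ n\<close> compares letter sums with
  \<open>t\<close> times lengths.\<close>

lemma power_convergent_consequences:
  assumes conv: "strongly_power_convergent T"
  obtains l where "natural_length_function \<rho> l" letter_frequencies
proof -
  define u :: "'a \<Rightarrow>\<^sub>C real" where "u = const_bcontfun 1"
  obtain l where lim: "(\<lambda>n. (T ^^ n) u) \<longlonglongrightarrow> l"
    using conv unfolding strongly_power_convergent_def convergent_def by blast
  have Ml: "M l = r *\<^sub>R l"
    by (rule limit_T_fixed[OF lim])
  have r: "0 < r" using one_le_spectral_radius by simp
  have tendsto_apply: "(\<lambda>n. apply_bcontfun (g n) a) \<longlonglongrightarrow> apply_bcontfun h a"
    if "g \<longlonglongrightarrow> h" for g and h :: "'a \<Rightarrow>\<^sub>C real" and a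
    using tendsto_uniform_limitI[OF tendsto_bcontfun_uniform_limit[OF that]] by blast
  have "0 \<le> apply_bcontfun l a" for a
    by (rule LIMSEQ_le_const[OF tendsto_apply[OF lim]])
      (use r in \<open>auto simp: T_pow u_def M_pow_one intro!: exI[of _ 0]\<close>)
  \<comment> \<open>If the limit vanished, some power of \<open>T\<close> would send 1 below 1/2;
    \<open>Suc N\<close> provides the positive exponent.\<close>
  moreover have "l \<noteq> 0"
  proof
    assume "l = 0"
    then have "(\<lambda>n. (T ^^ n) u) \<longlonglongrightarrow> 0" using lim by simp
    from LIMSEQ_D[OF this, of "1 / 2"]
    obtain N where N: "\<And>n. N \<le> n \<Longrightarrow> norm ((T ^^ n) u) < 1 / 2" by auto
    show False
    proof (rule T_pow_one_not_small)
      show "0 < Suc N" by simp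
      show "apply_bcontfun ((T ^^ Suc N) (const_bcontfun 1)) a \<le> 1 / 2" for a
        using N[of "Suc N"] norm_bounded[of "(T ^^ Suc N) u" a] unfolding u_def real_norm_def by linarith
    qed
  qed
  ultimately have l: "natural_length_function \<rho> l"
    unfolding natural_length_function_def using Ml r by (auto intro!: exI[of _ r])
  obtain m where m: "0 < m" "\<And>n a. m * r ^ n \<le> real (length (iter n [a]))"
    using natural_length_function_growth[OF l] by metis
  have letter_frequencies
    unfolding letter_frequencies_def
  proof (intro allI impI)
    fix f :: "'a \<Rightarrow> real"
    assume f: "continuous_on UNIV f"
    have "bounded (range f)"
      using compact_continuous_image[OF f compact_alphabet] compact_imp_bounded by blast
    then obtain F where F: "apply_bcontfun F = f"
      using f Bcontfun_inverse[of f] by (auto simp: bcontfun_def)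
    obtain h where h: "(\<lambda>n. (T ^^ n) F) \<longlonglongrightarrow> h"
      using conv unfolding strongly_power_convergent_def convergent_def by blast
    obtain t where t: "h = t *\<^sub>R l"
      by (rule fixed_point_unique[OF l Ml limit_T_fixed[OF h]])
    have "(\<lambda>n. (T ^^ n) F - t *\<^sub>R (T ^^ n) u) \<longlonglongrightarrow> h - t *\<^sub>R l"
      by (intro tendsto_intros h lim)
    then have zero: "(\<lambda>n. (T ^^ n) F - t *\<^sub>R (T ^^ n) u) \<longlonglongrightarrow> 0"
      by (simp add: t)
    show "\<exists>c. \<forall>e>0. \<exists>Q. \<forall>q\<ge>Q. \<forall>b. \<bar>(\<Sum>x\<leftarrow>iter q [b]. f x) - c * real (length (iter q [b]))\<bar>
        \<le> e * real (length (iter q [b]))"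
    proof (intro exI[of _ t] allI impI)
      fix e :: real
      assume e: "0 < e"
      \<comment> \<open>The lower bound \<open>m * r ^ q\<close> on lengths turns an error
        \<open>e * m * r ^ q\<close> into one relative to the length.\<close>
      then have "0 < e * m" using m by simp
      from LIMSEQ_D[OF zero this]
      obtain Q where Q: "\<And>q. Q \<le> q \<Longrightarrow> norm ((T ^^ q) F - t *\<^sub>R (T ^^ q) u) < e * m" by auto
      have "\<bar>(\<Sum>x\<leftarrow>iter q [b]. f x) - t * real (length (iter q [b]))\<bar> \<le> e * real (length (iter q [b]))"
        if "Q \<le> q" for q b
      proof -
        have rq: "0 < r ^ q" using r by simp
        have "(\<Sum>x\<leftarrow>iter q [b]. f x) - t * real (length (iter q [b]))
            = r ^ q * apply_bcontfun ((T ^^ q) F - t *\<^sub>R (T ^^ q) u) b"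
          using r by (simp add: T_pow M_pow_one u_def M_pow[of q F] F right_diff_distrib)
        then have "\<bar>(\<Sum>x\<leftarrow>iter q [b]. f x) - t * real (length (iter q [b]))\<bar>
            = r ^ q * \<bar>apply_bcontfun ((T ^^ q) F - t *\<^sub>R (T ^^ q) u) b\<bar>"
          using rq by (simp only: abs_mult abs_of_pos)
        also have "\<dots> \<le> r ^ q * (e * m)"
          using norm_bounded[of "(T ^^ q) F - t *\<^sub>R (T ^^ q) u" b] Q[OF that] rq
          by (intro mult_left_mono) (auto simp only: real_norm_def)
        also have "\<dots> \<le> e * real (length (iter q [b]))"
          using mult_left_mono[OF m(2)[of q b], of e] e by (simp add: mult_ac)
        finally show ?thesis .
      qed
      then show "\<exists>Q. \<forall>q\<ge>Q. \<forall>b. \<bar>(\<Sum>x\<leftarrow>iter q [b]. f x) - t * real (length (iter q [b]))\<bar>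
          \<le> e * real (length (iter q [b]))" by blast
    qed
  qed
  then show thesis using that l by blast
qed

end

theorem theorem1p1:
  fixes \<rho> :: "'a::t2_space \<Rightarrow> 'a list"
  assumes "compact (UNIV :: 'a set)"
    and "substitution \<rho>"
    and "irreducible_subst \<rho>"
  shows "(strongly_power_convergent (normalised_operator \<rho>) \<longrightarrow>
            uniquely_ergodic (subshift \<rho>) shift \<and> (\<exists>l. natural_length_function \<rho> l)) \<and>
         ((\<exists>l. natural_length_function \<rho> l) \<and> uniquely_ergodic (subshift \<rho>) shift \<longrightarrow>
            strongly_power_convergent (normalised_operator \<rho>))"
proof -
  interpret irreducible_substitution \<rho>
    using assms by unfold_locales
  show ?thesis
  proof (intro conjI impI)
    assume "strongly_power_convergent (normalised_operator \<rho>)"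
    then obtain l where l: "natural_length_function \<rho> l" and letter_frequencies
      by (rule power_convergent_consequences)
    then show "uniquely_ergodic (subshift \<rho>) shift" "\<exists>l. natural_length_function \<rho> l"
      using uniquely_ergodic_if_letter_frequencies uniform_growth_of_length_function by blast+
  next
    assume "(\<exists>l. natural_length_function \<rho> l) \<and> uniquely_ergodic (subshift \<rho>) shift"
    then obtain l where l: "natural_length_function \<rho> l" and "uniquely_ergodic (subshift \<rho>) shift"
      by blast
    then have letter_frequencies
      using letter_frequencies_if_uniquely_ergodic uniform_growth_of_length_function by blast
    with l show "strongly_power_convergent (normalised_operator \<rho>)"
      by (rule strongly_power_convergent_if_letter_frequencies)
  qed
qed

end
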